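(* Let $K$ be a field of characteristic zero, let $V$ be a $K$-vector space and let $L$ be the free pre-Lie algebra generated by $V$. Then there is an isomorphism of right $\mathcal U(L_{\mathrm{Lie}})$-modules $$L\simeq V\otimes\mathcal U(L_{\mathrm{Lie}}).$$
   Context: A pre-Lie algebra is a $K$-vector space $L$ with a bilinear product $\cdot:L\times L\to L$ such that $(x\cdot y)\cdot z-x\cdot(y\cdot z)=(x\cdot z)\cdot y-x\cdot(z\cdot y)$ for all $x,y,z\in L$. The bracket $[a,b]=a\cdot b-b\cdot a$ makes $L$ a Lie algebra, denoted $L_{\mathrm{Lie}}$; $\mathcal U(L_{\mathrm{Lie}})$ is its universal enveloping algebra. The map $L\times L_{\mathrm{Lie}}\to L$, $(v,g)\mapsto v\cdot g$, makes $L$ a right $L_{\mathrm{Lie}}$-module, hence a right $\mathcal U(L_{\mathrm{Lie}})$-module via $l\cdot(a_1\otimes\cdots\otimes a_n)=(\cdots((l\cdot a_1)\cdot a_2)\cdots)\cdot a_n$ (here $a_1\otimes\cdots\otimes a_n$ denotes the product of $a_1,\dots,a_n\in L$ in $\mathcal U(L_{\mathrm{Lie}})$). The right module structure on $V\otimes\mathcal U(L_{\mathrm{Lie}})$ is the free one, by right multiplication on the second factor. *)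

theory Defs
  imports "HOL-Algebra.Module" "HOL-Algebra.QuotRing"
begin

text \<open>
  Every space and algebra below is a record of type \<open>('a, 'b) module\<close>: \<open>smult\<close> is the action of
  the ground field and \<open>mult\<close> the product of the algebra, which need not be associative. For
  spaces without product, \<open>mult\<close> and \<open>one\<close> carry no meaning; for algebras without unit, \<open>one\<close>
  carries no meaning.
\<close>

definition char_zero :: "('k, 'r) ring_scheme \<Rightarrow> bool" where
  "char_zero K \<longleftrightarrow> (\<forall>n::nat. add_pow K n \<one>\<^bsub>K\<^esub> = \<zero>\<^bsub>K\<^esub> \<longrightarrow> n = 0)"


section \<open>Free vector spaces and quotients\<close>

definition free_module :: "('k, 'r) ring_scheme \<Rightarrow> 'x set \<Rightarrow> ('k, 'x \<Rightarrow> 'k) module" where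
  "free_module K X =
    \<lparr>carrier = {f. (\<forall>x. f x \<in> carrier K) \<and> (\<forall>x. x \<notin> X \<longrightarrow> f x = \<zero>\<^bsub>K\<^esub>) \<and> finite {x. f x \<noteq> \<zero>\<^bsub>K\<^esub>}},
     mult = undefined, one = undefined,
     zero = (\<lambda>x. \<zero>\<^bsub>K\<^esub>), add = (\<lambda>f g x. f x \<oplus>\<^bsub>K\<^esub> g x), smult = (\<lambda>c f x. c \<otimes>\<^bsub>K\<^esub> f x)\<rparr>"

definition single :: "('k, 'r) ring_scheme \<Rightarrow> 'x \<Rightarrow> 'x \<Rightarrow> 'k" where
  "single K x = (\<lambda>y. if y = x then \<one>\<^bsub>K\<^esub> else \<zero>\<^bsub>K\<^esub>)"

definition linear_extension ::
  "('k, 'r) ring_scheme \<Rightarrow> ('k, 'm, 's) module_scheme \<Rightarrow> ('x \<Rightarrow> 'm) \<Rightarrow> ('x \<Rightarrow> 'k) \<Rightarrow> 'm" where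
  "linear_extension K M g f = (\<Oplus>\<^bsub>M\<^esub>x\<in>{x. f x \<noteq> \<zero>\<^bsub>K\<^esub>}. f x \<odot>\<^bsub>M\<^esub> g x)"

definition quotient_algebra ::
  "('k, 'a, 's) module_scheme \<Rightarrow> 'a set \<Rightarrow> ('k, 'a set) module" where
  "quotient_algebra A I =
    ring.extend (A Quot I) (module.fields (\<lambda>c X. \<Union>x\<in>X. I +>\<^bsub>A\<^esub> (c \<odot>\<^bsub>A\<^esub> x)))"

definition generated_submodule ::
  "('k, 'r) ring_scheme \<Rightarrow> ('k, 'a, 's) module_scheme \<Rightarrow> 'a set \<Rightarrow> 'a set" where
  "generated_submodule K M S = \<Inter>{N. submodule N K M \<and> S \<subseteq> N}"

text \<open>The library's \<open>genideal\<close> presupposes an associative unital ring.\<close>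

definition generated_nonassoc_ideal ::
  "('k, 'r) ring_scheme \<Rightarrow> ('k, 'a, 's) module_scheme \<Rightarrow> 'a set \<Rightarrow> 'a set" where
  "generated_nonassoc_ideal K A S =
    \<Inter>{I. submodule I K A \<and>
        (\<forall>a\<in>carrier A. \<forall>x\<in>I. a \<otimes>\<^bsub>A\<^esub> x \<in> I \<and> x \<otimes>\<^bsub>A\<^esub> a \<in> I) \<and> S \<subseteq> I}"

text \<open>Killing these elements of \<open>A\<close> makes the map \<open>e\<close> from \<open>V\<close> to \<open>A\<close> linear.\<close>

definition linear_relators ::
  "('k, 'r) ring_scheme \<Rightarrow> ('k, 'v, 's) module_scheme \<Rightarrow> ('k, 'a, 't) module_scheme \<Rightarrow>
   ('v \<Rightarrow> 'a) \<Rightarrow> 'a set" where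
  "linear_relators K V A e =
    {e (v \<oplus>\<^bsub>V\<^esub> w) \<ominus>\<^bsub>A\<^esub> (e v \<oplus>\<^bsub>A\<^esub> e w) | v w. v \<in> carrier V \<and> w \<in> carrier V} \<union>
    {e (c \<odot>\<^bsub>V\<^esub> v) \<ominus>\<^bsub>A\<^esub> (c \<odot>\<^bsub>A\<^esub> e v) | c v. c \<in> carrier K \<and> v \<in> carrier V}"


section \<open>The free pre-Lie algebra\<close>

datatype 'v magma = Gen 'v | Node "'v magma" "'v magma"

definition free_nonassoc_algebra ::
  "('k, 'r) ring_scheme \<Rightarrow> 'v set \<Rightarrow> ('k, 'v magma \<Rightarrow> 'k) module" where
  "free_nonassoc_algebra K X = (free_module K {t. set_magma t \<subseteq> X})
    \<lparr>mult := \<lambda>f g t. case t of Gen v \<Rightarrow> \<zero>\<^bsub>K\<^esub> | Node r s \<Rightarrow> f r \<otimes>\<^bsub>K\<^esub> g s\<rparr>"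

definition pre_Lie_relators :: "('k, 'a, 's) module_scheme \<Rightarrow> 'a set" where
  "pre_Lie_relators A =
    {((x \<otimes>\<^bsub>A\<^esub> y) \<otimes>\<^bsub>A\<^esub> z \<ominus>\<^bsub>A\<^esub> x \<otimes>\<^bsub>A\<^esub> (y \<otimes>\<^bsub>A\<^esub> z)) \<ominus>\<^bsub>A\<^esub>
     ((x \<otimes>\<^bsub>A\<^esub> z) \<otimes>\<^bsub>A\<^esub> y \<ominus>\<^bsub>A\<^esub> x \<otimes>\<^bsub>A\<^esub> (z \<otimes>\<^bsub>A\<^esub> y)) |
     x y z. x \<in> carrier A \<and> y \<in> carrier A \<and> z \<in> carrier A}"

definition free_pre_Lie ::
  "('k, 'r) ring_scheme \<Rightarrow> ('k, 'v, 's) module_scheme \<Rightarrow> ('k, ('v magma \<Rightarrow> 'k) set) module" where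
  "free_pre_Lie K V =
    (let A = free_nonassoc_algebra K (carrier V)
     in quotient_algebra A (generated_nonassoc_ideal K A
          (linear_relators K V A (\<lambda>v. single K (Gen v)) \<union> pre_Lie_relators A)))"

definition Lie_of :: "('k, 'l, 's) module_scheme \<Rightarrow> ('k, 'l, 's) module_scheme" where
  "Lie_of L = L\<lparr>mult := \<lambda>a b. a \<otimes>\<^bsub>L\<^esub> b \<ominus>\<^bsub>L\<^esub> b \<otimes>\<^bsub>L\<^esub> a\<rparr>"


section \<open>The universal enveloping algebra\<close>

text \<open>The product of noncommutative polynomials, seen as functions on words.\<close>

definition free_assoc_algebra ::
  "('k, 'r) ring_scheme \<Rightarrow> 'x set \<Rightarrow> ('k, 'x list \<Rightarrow> 'k) module" where
  "free_assoc_algebra K X = (free_module K (lists X))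
    \<lparr>mult := \<lambda>f g w. \<Oplus>\<^bsub>K\<^esub>i\<in>{..length w}. f (take i w) \<otimes>\<^bsub>K\<^esub> g (drop i w), one := single K []\<rparr>"

text \<open>
  The product of the record \<open>G\<close> is the Lie bracket. The tensor algebra of \<open>G\<close> is the free
  associative algebra on the set \<open>carrier G\<close> modulo linearity of the generators; this quotient and
  the one by the commutator relations are taken in one step.
\<close>

definition enveloping_algebra ::
  "('k, 'r) ring_scheme \<Rightarrow> ('k, 'l, 's) module_scheme \<Rightarrow> ('k, ('l list \<Rightarrow> 'k) set) module" where
  "enveloping_algebra K G =
    (let T = free_assoc_algebra K (carrier G); e = (\<lambda>a. single K [a])
     in quotient_algebra T (Idl\<^bsub>T\<^esub>
          (linear_relators K G T e \<union>
           {(e a \<otimes>\<^bsub>T\<^esub> e b \<ominus>\<^bsub>T\<^esub> e b \<otimes>\<^bsub>T\<^esub> e a) \<ominus>\<^bsub>T\<^esub> e (a \<otimes>\<^bsub>G\<^esub> b) |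
            a b. a \<in> carrier G \<and> b \<in> carrier G})))"


section \<open>Tensor products\<close>

definition tensor_relators ::
  "('k, 'r) ring_scheme \<Rightarrow> ('k, 'm, 's) module_scheme \<Rightarrow> ('k, 'n, 't) module_scheme \<Rightarrow>
   ('m \<times> 'n \<Rightarrow> 'k) set" where
  "tensor_relators K M N =
    (let F = free_module K (carrier M \<times> carrier N)
     in generated_submodule K F
          ((\<Union>n\<in>carrier N. linear_relators K M F (\<lambda>m. single K (m, n))) \<union>
           (\<Union>m\<in>carrier M. linear_relators K N F (\<lambda>n. single K (m, n)))))"

definition tensor_product ::
  "('k, 'r) ring_scheme \<Rightarrow> ('k, 'm, 's) module_scheme \<Rightarrow> ('k, 'n, 't) module_scheme \<Rightarrow>
   ('k, ('m \<times> 'n \<Rightarrow> 'k) set) module" where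
  "tensor_product K M N =
    quotient_algebra (free_module K (carrier M \<times> carrier N)) (tensor_relators K M N)"

definition pure_tensor ::
  "('k, 'r) ring_scheme \<Rightarrow> ('k, 'm, 's) module_scheme \<Rightarrow> ('k, 'n, 't) module_scheme \<Rightarrow>
   'm \<Rightarrow> 'n \<Rightarrow> ('m \<times> 'n \<Rightarrow> 'k) set" where
  "pure_tensor K M N m n =
    tensor_relators K M N +>\<^bsub>free_module K (carrier M \<times> carrier N)\<^esub> single K (m, n)"


section \<open>Right modules\<close>

locale assoc_algebra = module K U + ring U
  for K :: "('k, 'r) ring_scheme" and U :: "('k, 'u, 's) module_scheme" +
  assumes smult_mult_left:
      "\<lbrakk>c \<in> carrier K; x \<in> carrier U; y \<in> carrier U\<rbrakk> \<Longrightarrow>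
       (c \<odot>\<^bsub>U\<^esub> x) \<otimes>\<^bsub>U\<^esub> y = c \<odot>\<^bsub>U\<^esub> (x \<otimes>\<^bsub>U\<^esub> y)"
    and smult_mult_right:
      "\<lbrakk>c \<in> carrier K; x \<in> carrier U; y \<in> carrier U\<rbrakk> \<Longrightarrow>
       x \<otimes>\<^bsub>U\<^esub> (c \<odot>\<^bsub>U\<^esub> y) = c \<odot>\<^bsub>U\<^esub> (x \<otimes>\<^bsub>U\<^esub> y)"

locale right_module = U: assoc_algebra K U + M: module K M
  for K :: "('k, 'r) ring_scheme" and U :: "('k, 'u, 's) module_scheme"
    and M :: "('k, 'm, 't) module_scheme" and act :: "'m \<Rightarrow> 'u \<Rightarrow> 'm" +
  assumes act_closed: "\<lbrakk>x \<in> carrier M; u \<in> carrier U\<rbrakk> \<Longrightarrow> act x u \<in> carrier M"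
    and act_add_left: "\<lbrakk>x \<in> carrier M; y \<in> carrier M; u \<in> carrier U\<rbrakk> \<Longrightarrow>
      act (x \<oplus>\<^bsub>M\<^esub> y) u = act x u \<oplus>\<^bsub>M\<^esub> act y u"
    and act_add_right: "\<lbrakk>x \<in> carrier M; u \<in> carrier U; w \<in> carrier U\<rbrakk> \<Longrightarrow>
      act x (u \<oplus>\<^bsub>U\<^esub> w) = act x u \<oplus>\<^bsub>M\<^esub> act x w"
    and act_smult_left: "\<lbrakk>c \<in> carrier K; x \<in> carrier M; u \<in> carrier U\<rbrakk> \<Longrightarrow>
      act (c \<odot>\<^bsub>M\<^esub> x) u = c \<odot>\<^bsub>M\<^esub> act x u"
    and act_smult_right: "\<lbrakk>c \<in> carrier K; x \<in> carrier M; u \<in> carrier U\<rbrakk> \<Longrightarrow>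
      act x (c \<odot>\<^bsub>U\<^esub> u) = c \<odot>\<^bsub>M\<^esub> act x u"
    and act_one: "x \<in> carrier M \<Longrightarrow> act x \<one>\<^bsub>U\<^esub> = x"
    and act_mult: "\<lbrakk>x \<in> carrier M; u \<in> carrier U; w \<in> carrier U\<rbrakk> \<Longrightarrow>
      act x (u \<otimes>\<^bsub>U\<^esub> w) = act (act x u) w"

definition right_module_iso ::
  "('k, 'r) ring_scheme \<Rightarrow> ('k, 'u, 's) module_scheme \<Rightarrow>
   ('k, 'm, 't) module_scheme \<Rightarrow> ('m \<Rightarrow> 'u \<Rightarrow> 'm) \<Rightarrow>
   ('k, 'n, 'q) module_scheme \<Rightarrow> ('n \<Rightarrow> 'u \<Rightarrow> 'n) \<Rightarrow> ('m \<Rightarrow> 'n) set" where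
  "right_module_iso K U M actM N actN =
    {f. bij_betw f (carrier M) (carrier N) \<and>
        (\<forall>x\<in>carrier M. \<forall>y\<in>carrier M. f (x \<oplus>\<^bsub>M\<^esub> y) = f x \<oplus>\<^bsub>N\<^esub> f y) \<and>
        (\<forall>c\<in>carrier K. \<forall>x\<in>carrier M. f (c \<odot>\<^bsub>M\<^esub> x) = c \<odot>\<^bsub>N\<^esub> f x) \<and>
        (\<forall>x\<in>carrier M. \<forall>u\<in>carrier U. f (actM x u) = actN (f x) u)}"

text \<open>
  In the next two definitions an element of a quotient is a coset of finitely supported functions;
  \<open>the_elem\<close> takes the value that all representatives give.
\<close>

text \<open>On words: \<open>l \<cdot> (a\<^sub>1 \<otimes> \<dots> \<otimes> a\<^sub>n) = (\<dots>((l \<cdot> a\<^sub>1) \<cdot> a\<^sub>2)\<dots>) \<cdot> a\<^sub>n\<close>.\<close>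

definition pre_Lie_action ::
  "('k, 'r) ring_scheme \<Rightarrow> ('k, 'l, 's) module_scheme \<Rightarrow> 'l \<Rightarrow> ('l list \<Rightarrow> 'k) set \<Rightarrow> 'l" where
  "pre_Lie_action K L l u = the_elem (linear_extension K L (foldl (\<lambda>x a. x \<otimes>\<^bsub>L\<^esub> a) l) ` u)"

definition free_action ::
  "('k, 'r) ring_scheme \<Rightarrow> ('k, 'v, 's) module_scheme \<Rightarrow> ('k, 'u, 't) module_scheme \<Rightarrow>
   ('v \<times> 'u \<Rightarrow> 'k) set \<Rightarrow> 'u \<Rightarrow> ('v \<times> 'u \<Rightarrow> 'k) set" where
  "free_action K V U t w =
    the_elem (linear_extension K (tensor_product K V U)
      (\<lambda>(v, u). pure_tensor K V U v (u \<otimes>\<^bsub>U\<^esub> w)) ` t)"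

end

theory Submission
  imports Defs
begin

text \<open>
  Write \<open>[y]\<close> for the image in \<open>U = \<U>(L\<^sub>L\<^sub>i\<^sub>e)\<close> of an element \<open>y\<close> of the free pre-Lie algebra \<open>L\<close>
  on \<open>V\<close>. The right \<open>U\<close>-module \<open>L\<close> has the universal property of the free module on \<open>V\<close>: a linear
  map \<open>g\<close> from \<open>V\<close> to a right \<open>U\<close>-module \<open>M\<close> extends to \<open>\<phi>\<close> from \<open>L\<close> to \<open>M\<close> with
  \<open>\<phi> (x \<cdot> y) = \<phi> x \<cdot> [y]\<close> (\<open>module_map_extension\<close>). On the free nonassociative algebra, whose basis
  consists of the binary trees with leaves in \<open>V\<close>, this formula is a definition by recursion in which
  only the left factor is recursed into; the right factor enters through its class in \<open>L\<close>. Let \<open>I\<close> be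
  the ideal with quotient \<open>L\<close>. The elements of \<open>I\<close> that the recursively defined map kills form an ideal,
  since an element of \<open>I\<close> acts as zero when it is the right factor. This ideal contains the linearity
  relators because \<open>g\<close> is linear, and it contains the pre-Lie relators because the relation
  \<open>[y] [z] - [y \<cdot> z] = [z] [y] - [z \<cdot> y]\<close> holds in \<open>U\<close>. Hence it is all of \<open>I\<close>.

  For \<open>M = V \<otimes> U\<close> and \<open>g v = v \<otimes> 1\<close> this gives a module morphism \<open>\<phi>\<close>. In the other direction
  \<open>v \<otimes> u \<mapsto> v \<cdot> u\<close> is a module morphism \<open>\<psi>\<close>. As \<open>L\<close> is generated by \<open>V\<close> as a \<open>U\<close>-module, \<open>\<phi>\<close> and
  \<open>\<psi>\<close> are mutually inverse (\<open>right_module_iso_exists\<close>).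

  That \<open>L\<close> and \<open>V \<otimes> U\<close> are right modules is shown for any pre-Lie algebra
  (\<open>right_module_pre_Lie_action\<close>) and any associative algebra (\<open>right_module_free_action\<close>).
\<close>


section \<open>Linear maps and submodules\<close>

lemma (in abelian_group) minus_eq_zero_iff:
  assumes "x \<in> carrier G" and "y \<in> carrier G"
  shows "x \<ominus> y = \<zero> \<longleftrightarrow> x = y"
  using assms by (metis minus_eq a_inv_closed minus_equality minus_minus r_neg)

lemma (in abelian_group) minus_eq_minus_swap:
  assumes c: "p \<in> carrier G" "q \<in> carrier G" "r \<in> carrier G" "s \<in> carrier G"
    and eq: "p \<ominus> r = q \<ominus> s"
  shows "p \<ominus> q = r \<ominus> s"
proof -
  have "p = (p \<ominus> r) \<oplus> r" using c by (simp add: minus_eq a_assoc l_neg)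
  also have "\<dots> = (r \<ominus> s) \<oplus> q" unfolding eq using c by (simp add: minus_eq a_ac)
  finally have "p \<ominus> q = ((r \<ominus> s) \<oplus> q) \<ominus> q" by simp
  also have "\<dots> = r \<ominus> s"
    using c by (simp add: minus_eq a_assoc r_neg)
  finally show ?thesis .
qed

text \<open>
  Linear maps. Only the values on \<open>carrier M\<close> matter: \<open>f\<close> is not required to be extensional.
\<close>

definition linear_map ::
  "('k, 'r) ring_scheme \<Rightarrow> ('k, 'm, 's) module_scheme \<Rightarrow> ('k, 'n, 't) module_scheme \<Rightarrow>
   ('m \<Rightarrow> 'n) \<Rightarrow> bool" where
  "linear_map K M N f \<longleftrightarrow>
     (\<forall>x\<in>carrier M. f x \<in> carrier N) \<and>
     (\<forall>x\<in>carrier M. \<forall>y\<in>carrier M. f (x \<oplus>\<^bsub>M\<^esub> y) = f x \<oplus>\<^bsub>N\<^esub> f y) \<and>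
     (\<forall>c\<in>carrier K. \<forall>x\<in>carrier M. f (c \<odot>\<^bsub>M\<^esub> x) = c \<odot>\<^bsub>N\<^esub> f x)"

lemma linear_mapI:
  assumes "\<And>x. x \<in> carrier M \<Longrightarrow> f x \<in> carrier N"
    and "\<And>x y. \<lbrakk>x \<in> carrier M; y \<in> carrier M\<rbrakk> \<Longrightarrow> f (x \<oplus>\<^bsub>M\<^esub> y) = f x \<oplus>\<^bsub>N\<^esub> f y"
    and "\<And>c x. \<lbrakk>c \<in> carrier K; x \<in> carrier M\<rbrakk> \<Longrightarrow> f (c \<odot>\<^bsub>M\<^esub> x) = c \<odot>\<^bsub>N\<^esub> f x"
  shows "linear_map K M N f"
  using assms by (simp add: linear_map_def)

lemma linear_mapD:
  assumes "linear_map K M N f"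
  shows linear_map_closed: "x \<in> carrier M \<Longrightarrow> f x \<in> carrier N"
    and linear_map_add: "\<lbrakk>x \<in> carrier M; y \<in> carrier M\<rbrakk> \<Longrightarrow> f (x \<oplus>\<^bsub>M\<^esub> y) = f x \<oplus>\<^bsub>N\<^esub> f y"
    and linear_map_smult: "\<lbrakk>c \<in> carrier K; x \<in> carrier M\<rbrakk> \<Longrightarrow> f (c \<odot>\<^bsub>M\<^esub> x) = c \<odot>\<^bsub>N\<^esub> f x"
  using assms by (simp_all add: linear_map_def)

lemma linear_map_compose:
  assumes "linear_map K M N f" and "linear_map K N P g"
  shows "linear_map K M P (\<lambda>x. g (f x))"
  using assms by (simp add: linear_map_def)

lemma linear_map_cong:
  assumes "linear_map K M N f" and "module K M" and "\<And>x. x \<in> carrier M \<Longrightarrow> f x = g x"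
  shows "linear_map K M N g"
proof -
  interpret module K M by fact
  show ?thesis using assms(1) by (auto simp: linear_map_def assms(3)[symmetric])
qed

lemma linear_map_id: "linear_map K M M (\<lambda>x. x)"
  by (simp add: linear_map_def)

lemma linear_map_zero:
  assumes "linear_map K M N f" and "module K M" and "module K N"
  shows "f \<zero>\<^bsub>M\<^esub> = \<zero>\<^bsub>N\<^esub>"
proof -
  interpret M: module K M by fact
  interpret N: module K N by fact
  have "f (\<zero>\<^bsub>K\<^esub> \<odot>\<^bsub>M\<^esub> \<zero>\<^bsub>M\<^esub>) = \<zero>\<^bsub>K\<^esub> \<odot>\<^bsub>N\<^esub> f \<zero>\<^bsub>M\<^esub>"
    using linear_map_smult[OF assms(1)] by blast
  then show ?thesis using linear_map_closed[OF assms(1)] by simp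
qed

lemma linear_map_minus:
  assumes "linear_map K M N f" and "module K M" and "module K N" and x: "x \<in> carrier M"
  shows "f (\<ominus>\<^bsub>M\<^esub> x) = \<ominus>\<^bsub>N\<^esub> f x"
proof -
  interpret M: module K M by fact
  interpret N: module K N by fact
  have "f ((\<ominus>\<^bsub>K\<^esub> \<one>\<^bsub>K\<^esub>) \<odot>\<^bsub>M\<^esub> x) = (\<ominus>\<^bsub>K\<^esub> \<one>\<^bsub>K\<^esub>) \<odot>\<^bsub>N\<^esub> f x"
    using linear_map_smult[OF assms(1)] x by blast
  then show ?thesis using linear_map_closed[OF assms(1)] x
    by (simp add: M.smult_l_minus N.smult_l_minus)
qed

lemma linear_map_diff:
  assumes "linear_map K M N f" and "module K M" and "module K N"
    and "x \<in> carrier M" and "y \<in> carrier M"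
  shows "f (x \<ominus>\<^bsub>M\<^esub> y) = f x \<ominus>\<^bsub>N\<^esub> f y"
proof -
  interpret M: module K M by fact
  interpret N: module K N by fact
  show ?thesis using assms
    by (simp add: a_minus_def linear_map_add[OF assms(1)] linear_map_minus[OF assms(1-3)])
qed

lemma linear_map_const_zero:
  assumes "module K N" shows "linear_map K M N (\<lambda>x. \<zero>\<^bsub>N\<^esub>)"
proof -
  interpret N: module K N by fact
  show ?thesis by (simp add: linear_map_def)
qed

lemma linear_map_sum:
  assumes "linear_map K M N f" and "linear_map K M N g" and "module K N"
  shows "linear_map K M N (\<lambda>x. f x \<oplus>\<^bsub>N\<^esub> g x)"
proof -
  interpret N: module K N by fact
  show ?thesis
    using assms(1,2) by (auto simp: linear_map_def N.smult_r_distr N.a_ac)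
qed

lemma linear_map_scale:
  assumes "linear_map K M N f" and "c \<in> carrier K" and "module K N"
  shows "linear_map K M N (\<lambda>x. c \<odot>\<^bsub>N\<^esub> f x)"
proof -
  interpret N: module K N by fact
  show ?thesis
    using assms(1,2)
    by (auto simp: linear_map_def N.smult_r_distr N.R.m_comm N.smult_assoc1[symmetric])
qed

lemma submodule_kernel:
  assumes "linear_map K M N f" and "module K M" and "module K N"
  shows "submodule {x \<in> carrier M. f x = \<zero>\<^bsub>N\<^esub>} K M"
proof -
  interpret M: module K M by fact
  interpret N: module K N by fact
  note f = linear_mapD[OF assms(1)] linear_map_zero[OF assms] linear_map_minus[OF assms]
  show ?thesis by (rule M.submoduleI) (auto simp: f)
qed

lemma (in module) submodule_Int:
  assumes "submodule H R M" and "submodule H' R M"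
  shows "submodule (H \<inter> H') R M"
proof (rule submoduleI)
  show "\<zero>\<^bsub>M\<^esub> \<in> H \<inter> H'"
    using assms[THEN submodule.axioms(1), THEN subgroup.one_closed] by simp
qed (use assms[THEN submoduleE(1)] assms[THEN submoduleE(3)] assms[THEN submoduleE(4)]
      assms[THEN submoduleE(5)] in auto)

lemma (in module) submodule_Inter:
  assumes "\<And>H. H \<in> \<H> \<Longrightarrow> submodule H R M" and "\<H> \<noteq> {}"
  shows "submodule (\<Inter>\<H>) R M"
proof (rule submoduleI)
  show "\<zero>\<^bsub>M\<^esub> \<in> \<Inter>\<H>"
    using assms(1)[THEN submodule.axioms(1), THEN subgroup.one_closed] by auto
  show "\<Inter>\<H> \<subseteq> carrier M" using assms submoduleE(1) by blast
qed (use assms(1) submoduleE(3,4,5) in blast)+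

text \<open>
  The next lemma and \<open>linear_cls_relators\<close> below are the two halves of the meaning of
  \<open>linear_relators\<close>: a linear map \<open>h\<close> with \<open>h \<circ> e\<close> linear kills them, and killing them makes
  \<open>e\<close> followed by the projection linear.
\<close>

lemma linear_relators_vanish:
  assumes "linear_map K A P h" and "linear_map K V P (\<lambda>v. h (e v))"
    and "module K V" and "module K A" and "module K P"
    and e: "\<And>v. v \<in> carrier V \<Longrightarrow> e v \<in> carrier A"
    and "x \<in> linear_relators K V A e"
  shows "h x = \<zero>\<^bsub>P\<^esub>"
proof -
  interpret V: module K V by fact
  interpret A: module K A by fact
  interpret P: module K P by fact
  note h = linear_mapD[OF assms(1)] linear_map_diff[OF assms(1,4,5)]
  note he = linear_mapD[OF assms(2)]
  show ?thesis using assms(7)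
    by (auto simp: linear_relators_def h he e P.r_neg a_minus_def linear_map_minus[OF assms(1,4,5)])
qed

lemma linear_relators_subset:
  assumes "module K V" and "module K A" and "\<And>v. v \<in> carrier V \<Longrightarrow> e v \<in> carrier A"
  shows "linear_relators K V A e \<subseteq> carrier A"
proof -
  interpret V: module K V by fact
  interpret A: module K A by fact
  show ?thesis using assms(3) by (auto simp: linear_relators_def)
qed


section \<open>Quotients\<close>

text \<open>
  The quotient of a module by a submodule \<open>N\<close>. The record \<open>M\<close> may carry a product; it plays no
  role here.
\<close>

locale quotient_module = module K M
  for K :: "('k, 'r) ring_scheme" and M :: "('k, 'm, 's) module_scheme" +
  fixes N :: "'m set"
  assumes submodule: "submodule N K M"
begin

abbreviation Q :: "('k, 'm set) module" where "Q \<equiv> quotient_algebra M N"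

abbreviation cls :: "'m \<Rightarrow> 'm set" where "cls x \<equiv> N +>\<^bsub>M\<^esub> x"

lemma additive: "additive_subgroup N M"
  using submodule by (simp add: additive_subgroup_def submodule_def)

sublocale N: abelian_subgroup N M
  by (rule abelian_subgroupI3[OF additive M.abelian_group_axioms])

lemma cls_eq_iff:
  assumes "x \<in> carrier M" and "y \<in> carrier M"
  shows "cls x = cls y \<longleftrightarrow> x \<ominus>\<^bsub>M\<^esub> y \<in> N"
proof -
  have "cls x = cls y \<longleftrightarrow> x \<in> cls y"
    using assms N.a_repr_independence' N.a_rcos_self by metis
  then show ?thesis
    using N.a_rcos_module[OF assms(2,1)] by (simp add: M.minus_eq)
qed

lemma cls_memD:
  assumes "x \<in> carrier M" and "y \<in> cls x"
  shows "y \<in> carrier M" and "cls y = cls x"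
  using assms N.a_elemrcos_carrier N.a_repr_independence' by auto

lemma carrier_quotient: "carrier Q = cls ` carrier M"
  by (auto simp: quotient_algebra_def ring.extend_def FactRing_def A_RCOSETS_def')

lemma quotient_cases:
  assumes "X \<in> carrier Q" obtains x where "x \<in> carrier M" and "X = cls x"
  using assms by (auto simp: carrier_quotient)

lemma cls_closed: "x \<in> carrier M \<Longrightarrow> cls x \<in> carrier Q"
  by (simp add: carrier_quotient)

lemma cls_zero: "cls \<zero>\<^bsub>M\<^esub> = \<zero>\<^bsub>Q\<^esub>"
  by (simp add: quotient_algebra_def ring.extend_def FactRing_def N.a_subset)

lemma cls_eq_zero_iff:
  assumes "x \<in> carrier M" shows "cls x = \<zero>\<^bsub>Q\<^esub> \<longleftrightarrow> x \<in> N"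
proof -
  have "x \<ominus>\<^bsub>M\<^esub> \<zero>\<^bsub>M\<^esub> = x"
    using assms by (metis M.minus_eq M.minus_equality M.r_zero M.zero_closed)
  then show ?thesis
    using cls_eq_iff[OF assms M.zero_closed] by (simp only: cls_zero)
qed

lemma add_cls:
  "\<lbrakk>x \<in> carrier M; y \<in> carrier M\<rbrakk> \<Longrightarrow> cls x \<oplus>\<^bsub>Q\<^esub> cls y = cls (x \<oplus>\<^bsub>M\<^esub> y)"
  by (simp add: quotient_algebra_def ring.extend_def FactRing_def N.a_rcos_sum)

lemma smult_cls:
  assumes "c \<in> carrier K" and "x \<in> carrier M"
  shows "c \<odot>\<^bsub>Q\<^esub> cls x = cls (c \<odot>\<^bsub>M\<^esub> x)"
proof -
  have "cls (c \<odot>\<^bsub>M\<^esub> y) = cls (c \<odot>\<^bsub>M\<^esub> x)" if "y \<in> cls x" for y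
  proof -
    have y: "y \<in> carrier M" "y \<ominus>\<^bsub>M\<^esub> x \<in> N"
      using cls_memD[OF assms(2) that] cls_eq_iff assms(2) by auto
    have "c \<odot>\<^bsub>M\<^esub> y \<ominus>\<^bsub>M\<^esub> c \<odot>\<^bsub>M\<^esub> x = c \<odot>\<^bsub>M\<^esub> (y \<ominus>\<^bsub>M\<^esub> x)"
      using assms y by (simp add: a_minus_def smult_r_distr smult_r_minus)
    then have "c \<odot>\<^bsub>M\<^esub> y \<ominus>\<^bsub>M\<^esub> c \<odot>\<^bsub>M\<^esub> x \<in> N"
      using submodule.smult_closed[OF submodule assms(1) y(2)] by simp
    then show ?thesis using assms y by (simp add: cls_eq_iff)
  qed
  moreover have "x \<in> cls x" using assms N.a_rcos_self by simp
  ultimately have "(\<Union>y\<in>cls x. cls (c \<odot>\<^bsub>M\<^esub> y)) = cls (c \<odot>\<^bsub>M\<^esub> x)" by blast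
  then show ?thesis by (simp add: quotient_algebra_def ring.extend_def module.fields_def)
qed

lemma module_quotient: "module K Q"
proof (rule moduleI)
  show "abelian_group Q"
  proof (rule abelian_groupI)
    fix X assume "X \<in> carrier Q"
    then obtain x where x: "x \<in> carrier M" "X = cls x" by (rule quotient_cases)
    then show "\<exists>Y\<in>carrier Q. Y \<oplus>\<^bsub>Q\<^esub> X = \<zero>\<^bsub>Q\<^esub>"
      by (intro bexI[of _ "cls (\<ominus>\<^bsub>M\<^esub> x)"])
        (simp_all add: add_cls cls_closed l_neg cls_zero)
  qed (auto elim!: quotient_cases simp: add_cls cls_closed cls_zero[symmetric] a_ac)
qed (auto elim!: quotient_cases intro: R.is_cring
      simp: add_cls cls_closed smult_cls smult_l_distr smult_r_distr smult_assoc1)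

lemma linear_cls: "linear_map K M Q cls"
  by (rule linear_mapI) (simp_all add: cls_closed add_cls smult_cls)

text \<open>
  A linear map that kills \<open>N\<close> factors through the quotient. The induced map is
  \<open>\<lambda>X. the_elem (f ` X)\<close>, the form in which both module actions are defined.
\<close>

lemma the_elem_image_cls:
  assumes f: "linear_map K M P f" "module K P" and "\<And>x. x \<in> N \<Longrightarrow> f x = \<zero>\<^bsub>P\<^esub>"
    and x: "x \<in> carrier M"
  shows "the_elem (f ` cls x) = f x"
proof -
  interpret P: module K P by fact
  have "f y = f x" if "y \<in> cls x" for y
  proof -
    have y: "y \<in> carrier M" "y \<ominus>\<^bsub>M\<^esub> x \<in> N"
      using cls_memD[OF x that] cls_eq_iff x by auto
    have "f y \<ominus>\<^bsub>P\<^esub> f x = \<zero>\<^bsub>P\<^esub>"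
      using linear_map_diff[OF f(1) module_axioms f(2) y(1) x] assms(3)[OF y(2)] by simp
    then show ?thesis using linear_map_closed[OF f(1)] x y(1) P.minus_eq_zero_iff by blast
  qed
  then have "f ` cls x = {f x}" using N.a_rcos_self[OF x] by blast
  then show ?thesis by simp
qed

lemma linear_the_elem_image:
  assumes f: "linear_map K M P f" "module K P" and "\<And>x. x \<in> N \<Longrightarrow> f x = \<zero>\<^bsub>P\<^esub>"
  shows "linear_map K Q P (\<lambda>X. the_elem (f ` X))"
  by (rule linear_mapI)
    (auto elim!: quotient_cases
      simp: add_cls smult_cls the_elem_image_cls[OF assms] linear_mapD[OF f(1)])

lemma linear_cls_relators:
  assumes V: "module K V" and e: "\<And>v. v \<in> carrier V \<Longrightarrow> e v \<in> carrier M"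
    and sub: "linear_relators K V M e \<subseteq> N"
  shows "linear_map K V Q (\<lambda>v. cls (e v))"
proof -
  interpret V: module K V by fact
  show ?thesis
  proof (rule linear_mapI)
    fix v w assume "v \<in> carrier V" "w \<in> carrier V"
    moreover from this have "e (v \<oplus>\<^bsub>V\<^esub> w) \<ominus>\<^bsub>M\<^esub> (e v \<oplus>\<^bsub>M\<^esub> e w) \<in> N"
      using sub unfolding linear_relators_def by blast
    ultimately show "cls (e (v \<oplus>\<^bsub>V\<^esub> w)) = cls (e v) \<oplus>\<^bsub>Q\<^esub> cls (e w)"
      by (simp add: add_cls e cls_eq_iff)
  next
    fix c v assume "c \<in> carrier K" "v \<in> carrier V"
    moreover from this have "e (c \<odot>\<^bsub>V\<^esub> v) \<ominus>\<^bsub>M\<^esub> (c \<odot>\<^bsub>M\<^esub> e v) \<in> N"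
      using sub unfolding linear_relators_def by blast
    ultimately show "cls (e (c \<odot>\<^bsub>V\<^esub> v)) = c \<odot>\<^bsub>Q\<^esub> cls (e v)"
      by (simp add: smult_cls e cls_eq_iff)
  qed (simp add: e cls_closed)
qed

end

text \<open>
  An algebra, not assumed associative or unital: a module with a bilinear product. Bilinearity is the
  linearity of all left and right multiplications; this includes closure under the product.
\<close>

locale nonassoc_algebra = module K A
  for K :: "('k, 'r) ring_scheme" and A :: "('k, 'a, 's) module_scheme" +
  assumes mult_linear_left: "y \<in> carrier A \<Longrightarrow> linear_map K A A (\<lambda>x. x \<otimes>\<^bsub>A\<^esub> y)"
    and mult_linear_right: "x \<in> carrier A \<Longrightarrow> linear_map K A A (\<lambda>y. x \<otimes>\<^bsub>A\<^esub> y)"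
begin

lemma mult_closed: "\<lbrakk>x \<in> carrier A; y \<in> carrier A\<rbrakk> \<Longrightarrow> x \<otimes>\<^bsub>A\<^esub> y \<in> carrier A"
  using mult_linear_left linear_map_closed by fastforce

lemma linear_map_mult_left:
  assumes "linear_map K M A f" and "y \<in> carrier A"
  shows "linear_map K M A (\<lambda>x. f x \<otimes>\<^bsub>A\<^esub> y)"
  using linear_map_compose[OF assms(1) mult_linear_left[OF assms(2)]] .

lemma linear_map_mult_right:
  assumes "linear_map K M A f" and "x \<in> carrier A"
  shows "linear_map K M A (\<lambda>y. x \<otimes>\<^bsub>A\<^esub> f y)"
  using linear_map_compose[OF assms(1) mult_linear_right[OF assms(2)]] .

lemma assoc_algebraI:
  assumes "\<And>x y z. \<lbrakk>x \<in> carrier A; y \<in> carrier A; z \<in> carrier A\<rbrakk> \<Longrightarrow>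
        (x \<otimes>\<^bsub>A\<^esub> y) \<otimes>\<^bsub>A\<^esub> z = x \<otimes>\<^bsub>A\<^esub> (y \<otimes>\<^bsub>A\<^esub> z)"
    and "\<one>\<^bsub>A\<^esub> \<in> carrier A"
    and "\<And>x. x \<in> carrier A \<Longrightarrow> \<one>\<^bsub>A\<^esub> \<otimes>\<^bsub>A\<^esub> x = x"
    and "\<And>x. x \<in> carrier A \<Longrightarrow> x \<otimes>\<^bsub>A\<^esub> \<one>\<^bsub>A\<^esub> = x"
  shows "assoc_algebra K A"
proof -
  have "ring A"
    using assms by (intro ringI monoidI)
      (simp_all add: M.abelian_group_axioms mult_closed linear_map_add[OF mult_linear_left]
        linear_map_add[OF mult_linear_right])
  then show ?thesis
    by (intro assoc_algebra.intro assoc_algebra_axioms.intro)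
      (simp_all add: module_axioms linear_map_smult[OF mult_linear_left]
        linear_map_smult[OF mult_linear_right])
qed

end

sublocale assoc_algebra \<subseteq> nonassoc_algebra K U
  by unfold_locales
    (auto intro!: linear_mapI simp: l_distr r_distr smult_mult_left smult_mult_right)

text \<open>The quotient of such an algebra by a two-sided ideal.\<close>

locale quotient_nonassoc_algebra = nonassoc_algebra K M + quotient_module K M N
  for K :: "('k, 'r) ring_scheme" and M :: "('k, 'm, 's) module_scheme" and N :: "'m set" +
  assumes ideal_left: "\<lbrakk>a \<in> carrier M; x \<in> N\<rbrakk> \<Longrightarrow> a \<otimes>\<^bsub>M\<^esub> x \<in> N"
    and ideal_right: "\<lbrakk>a \<in> carrier M; x \<in> N\<rbrakk> \<Longrightarrow> x \<otimes>\<^bsub>M\<^esub> a \<in> N"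
begin

lemma mult_cls:
  assumes x: "x \<in> carrier M" and y: "y \<in> carrier M"
  shows "cls x \<otimes>\<^bsub>Q\<^esub> cls y = cls (x \<otimes>\<^bsub>M\<^esub> y)"
proof -
  have "cls (a \<otimes>\<^bsub>M\<^esub> b) = cls (x \<otimes>\<^bsub>M\<^esub> y)" if "a \<in> cls x" "b \<in> cls y" for a b
  proof -
    have a: "a \<in> carrier M" "a \<ominus>\<^bsub>M\<^esub> x \<in> N" and b: "b \<in> carrier M" "b \<ominus>\<^bsub>M\<^esub> y \<in> N"
      using cls_memD[OF x that(1)] cls_memD[OF y that(2)] x y by (auto simp: cls_eq_iff[symmetric])
    have "(a \<otimes>\<^bsub>M\<^esub> b) \<ominus>\<^bsub>M\<^esub> (x \<otimes>\<^bsub>M\<^esub> b) \<in> N"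
      using ideal_right[OF b(1) a(2)] a b x
      by (simp add: linear_map_diff[OF mult_linear_left module_axioms module_axioms])
    then have "cls (a \<otimes>\<^bsub>M\<^esub> b) = cls (x \<otimes>\<^bsub>M\<^esub> b)"
      using a b x by (simp add: cls_eq_iff mult_closed)
    moreover have "(x \<otimes>\<^bsub>M\<^esub> b) \<ominus>\<^bsub>M\<^esub> (x \<otimes>\<^bsub>M\<^esub> y) \<in> N"
      using ideal_left[OF x b(2)] b x y
      by (simp add: linear_map_diff[OF mult_linear_right module_axioms module_axioms])
    then have "cls (x \<otimes>\<^bsub>M\<^esub> b) = cls (x \<otimes>\<^bsub>M\<^esub> y)"
      using b x y by (simp add: cls_eq_iff mult_closed)
    ultimately show ?thesis by simp
  qed
  moreover have "x \<in> cls x" "y \<in> cls y" using x y N.a_rcos_self by auto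
  ultimately have "(\<Union>a\<in>cls x. \<Union>b\<in>cls y. cls (a \<otimes>\<^bsub>M\<^esub> b)) = cls (x \<otimes>\<^bsub>M\<^esub> y)" by blast
  then show ?thesis
    by (simp add: quotient_algebra_def ring.extend_def FactRing_def rcoset_mult_def)
qed

lemma one_quotient: "\<one>\<^bsub>Q\<^esub> = cls \<one>\<^bsub>M\<^esub>"
  by (simp add: quotient_algebra_def ring.extend_def FactRing_def)

lemma nonassoc_algebra_quotient: "nonassoc_algebra K Q"
  by (intro nonassoc_algebra.intro nonassoc_algebra_axioms.intro module_quotient linear_mapI)
    (auto elim!: quotient_cases simp: mult_cls add_cls smult_cls cls_closed mult_closed
      linear_map_add[OF mult_linear_left] linear_map_add[OF mult_linear_right]
      linear_map_smult[OF mult_linear_left] linear_map_smult[OF mult_linear_right])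

end


section \<open>Free modules\<close>

text \<open>
  The module underlying the record \<open>M\<close> is the free module on \<open>X\<close>, whatever product and unit \<open>M\<close>
  has. This covers \<open>free_module\<close> itself and the two free algebras that are built on it.
\<close>

locale free_on = K: cring K
  for K :: "('k, 'r) ring_scheme" and X :: "'x set" and M :: "('k, 'x \<Rightarrow> 'k, 's) module_scheme" +
  assumes carrier_eq: "carrier M = carrier (free_module K X)"
    and zero_eq: "\<zero>\<^bsub>M\<^esub> = \<zero>\<^bsub>free_module K X\<^esub>"
    and add_eq: "add M = add (free_module K X)"
    and smult_eq: "smult M = smult (free_module K X)"
begin

lemma carrier_iff:
  "f \<in> carrier M \<longleftrightarrow>
     (\<forall>x. f x \<in> carrier K) \<and> (\<forall>x. x \<notin> X \<longrightarrow> f x = \<zero>\<^bsub>K\<^esub>) \<and> finite {x. f x \<noteq> \<zero>\<^bsub>K\<^esub>}"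
  by (simp add: carrier_eq free_module_def)

lemma coeff_closed: "f \<in> carrier M \<Longrightarrow> f x \<in> carrier K"
  and coeff_outside: "\<lbrakk>f \<in> carrier M; x \<notin> X\<rbrakk> \<Longrightarrow> f x = \<zero>\<^bsub>K\<^esub>"
  and finite_support: "f \<in> carrier M \<Longrightarrow> finite {x. f x \<noteq> \<zero>\<^bsub>K\<^esub>}"
  by (simp_all add: carrier_iff)

lemma add_apply: "f \<oplus>\<^bsub>M\<^esub> g = (\<lambda>x. f x \<oplus>\<^bsub>K\<^esub> g x)"
  by (simp add: add_eq free_module_def)

lemma smult_apply: "c \<odot>\<^bsub>M\<^esub> f = (\<lambda>x. c \<otimes>\<^bsub>K\<^esub> f x)"
  by (simp add: smult_eq free_module_def)

lemma zero_apply: "\<zero>\<^bsub>M\<^esub> = (\<lambda>x. \<zero>\<^bsub>K\<^esub>)"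
  by (simp add: zero_eq free_module_def)

lemma add_mem:
  assumes "f \<in> carrier M" and "g \<in> carrier M"
  shows "(\<lambda>x. f x \<oplus>\<^bsub>K\<^esub> g x) \<in> carrier M"
proof -
  have "finite ({x. f x \<noteq> \<zero>\<^bsub>K\<^esub>} \<union> {x. g x \<noteq> \<zero>\<^bsub>K\<^esub>})"
    using assms finite_support by blast
  moreover have "{x. f x \<oplus>\<^bsub>K\<^esub> g x \<noteq> \<zero>\<^bsub>K\<^esub>} \<subseteq> {x. f x \<noteq> \<zero>\<^bsub>K\<^esub>} \<union> {x. g x \<noteq> \<zero>\<^bsub>K\<^esub>}"
    by auto
  ultimately show ?thesis using assms by (auto simp: carrier_iff intro: finite_subset)
qed

lemma smult_mem:
  assumes "c \<in> carrier K" and "f \<in> carrier M"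
  shows "(\<lambda>x. c \<otimes>\<^bsub>K\<^esub> f x) \<in> carrier M"
proof -
  have "{x. c \<otimes>\<^bsub>K\<^esub> f x \<noteq> \<zero>\<^bsub>K\<^esub>} \<subseteq> {x. f x \<noteq> \<zero>\<^bsub>K\<^esub>}"
    using assms by auto
  then show ?thesis using assms by (auto simp: carrier_iff intro: finite_subset)
qed

sublocale module K M
proof (rule moduleI)
  show "abelian_group M"
  proof (rule abelian_groupI)
    fix f assume f: "f \<in> carrier M"
    have "(\<lambda>x. \<ominus>\<^bsub>K\<^esub> \<one>\<^bsub>K\<^esub> \<otimes>\<^bsub>K\<^esub> f x) \<in> carrier M"
      using f by (intro smult_mem) simp_all
    then show "\<exists>g\<in>carrier M. g \<oplus>\<^bsub>M\<^esub> f = \<zero>\<^bsub>M\<^esub>"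
      using f by (intro bexI[of _ "\<lambda>x. \<ominus>\<^bsub>K\<^esub> \<one>\<^bsub>K\<^esub> \<otimes>\<^bsub>K\<^esub> f x"])
        (simp_all add: add_apply zero_apply coeff_closed K.l_minus K.l_neg)
  qed (auto simp: add_apply zero_apply add_mem coeff_closed K.a_ac simp: carrier_iff[of "\<lambda>x. \<zero>\<^bsub>K\<^esub>"])
qed (auto simp: add_apply smult_apply smult_mem coeff_closed K.l_distr K.r_distr K.m_assoc K.is_cring)

lemma single_closed:
  assumes "x \<in> X" shows "single K x \<in> carrier M"
proof -
  have "{y. single K x y \<noteq> \<zero>\<^bsub>K\<^esub>} \<subseteq> {x}" by (auto simp: single_def)
  then show ?thesis
    using assms finite_subset by (fastforce simp: carrier_iff single_def)
qed

lemma free_induct [consumes 1, case_names zero step]: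
  assumes "f \<in> carrier M"
    and zero: "P \<zero>\<^bsub>M\<^esub>"
    and step: "\<And>c x g. \<lbrakk>c \<in> carrier K; x \<in> X; g \<in> carrier M; P g\<rbrakk> \<Longrightarrow> P (g \<oplus>\<^bsub>M\<^esub> c \<odot>\<^bsub>M\<^esub> single K x)"
  shows "P f"
proof -
  have "P f" if "finite S" "{x. f x \<noteq> \<zero>\<^bsub>K\<^esub>} \<subseteq> S" "S \<subseteq> X" "f \<in> carrier M" for S f
    using that
  proof (induction S arbitrary: f rule: finite_induct)
    case empty
    then have "f = \<zero>\<^bsub>M\<^esub>" by (auto simp: zero_apply)
    with zero show ?case by simp
  next
    case (insert x S)
    define g where "g = f(x := \<zero>\<^bsub>K\<^esub>)"
    have "{y. g y \<noteq> \<zero>\<^bsub>K\<^esub>} \<subseteq> {y. f y \<noteq> \<zero>\<^bsub>K\<^esub>}" by (auto simp: g_def)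
    then have g: "g \<in> carrier M"
      using insert.prems(3) by (auto simp: carrier_iff g_def intro: finite_subset)
    have "P g"
      using insert.prems by (intro insert.IH g) (auto simp: g_def)
    moreover have "f = g \<oplus>\<^bsub>M\<^esub> f x \<odot>\<^bsub>M\<^esub> single K x"
      using insert.prems(3)
      by (auto simp: fun_eq_iff add_apply smult_apply single_def g_def coeff_closed)
    ultimately show ?case
      using step[of "f x" x g] insert.prems g by (simp add: coeff_closed)
  qed
  from this[of "{x. f x \<noteq> \<zero>\<^bsub>K\<^esub>}" f] show ?thesis
    using assms(1) finite_support coeff_outside by blast
qed

text \<open>
  Multilinear identities are reduced to basis elements with this lemma, one argument at a time.
\<close>

lemma linear_map_eq_on_basis:
  assumes f: "linear_map K M P f" and g: "linear_map K M P g" and P: "module K P"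
    and eq: "\<And>x. x \<in> X \<Longrightarrow> f (single K x) = g (single K x)"
    and u: "u \<in> carrier M"
  shows "f u = g u"
  using u
proof (induction rule: free_induct)
  case zero
  then show ?case using linear_map_zero[OF f module_axioms P] linear_map_zero[OF g module_axioms P] by simp
next
  case (step c x h)
  then show ?case
    by (simp add: linear_map_add[OF f] linear_map_add[OF g] linear_map_smult[OF f]
        linear_map_smult[OF g] single_closed eq)
qed

lemma linear_extension_eq_finsum:
  assumes P: "module K P" and g: "\<And>x. x \<in> X \<Longrightarrow> g x \<in> carrier P"
    and f: "f \<in> carrier M" and B: "finite B" "{x. f x \<noteq> \<zero>\<^bsub>K\<^esub>} \<subseteq> B" "B \<subseteq> X"
  shows "linear_extension K P g f = (\<Oplus>\<^bsub>P\<^esub>x\<in>B. f x \<odot>\<^bsub>P\<^esub> g x)"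
proof -
  interpret P: module K P by fact
  show ?thesis unfolding linear_extension_def
    by (rule P.add.finprod_mono_neutral_cong_left) (use B in \<open>auto simp: g coeff_closed[OF f]\<close>)
qed

lemma linear_linear_extension:
  assumes P: "module K P" and g: "\<And>x. x \<in> X \<Longrightarrow> g x \<in> carrier P"
  shows "linear_map K M P (linear_extension K P g)"
proof -
  interpret P: module K P by fact
  note eq = linear_extension_eq_finsum[OF P g]
  have supp: "{x. f x \<noteq> \<zero>\<^bsub>K\<^esub>} \<subseteq> X" if "f \<in> carrier M" for f
    using that coeff_outside by blast
  show ?thesis
  proof (rule linear_mapI)
    fix f assume f: "f \<in> carrier M"
    then show "linear_extension K P g f \<in> carrier P"
      unfolding linear_extension_def using supp[OF f]
      by (intro P.finsum_closed) (auto simp: coeff_closed g)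
  next
    fix f h assume f: "f \<in> carrier M" and h: "h \<in> carrier M"
    let ?B = "{x. f x \<noteq> \<zero>\<^bsub>K\<^esub>} \<union> {x. h x \<noteq> \<zero>\<^bsub>K\<^esub>}"
    have B: "finite ?B" "?B \<subseteq> X" using supp f h finite_support by auto
    have s: "{x. (f \<oplus>\<^bsub>M\<^esub> h) x \<noteq> \<zero>\<^bsub>K\<^esub>} \<subseteq> ?B" by (auto simp: add_apply)
    have "linear_extension K P g (f \<oplus>\<^bsub>M\<^esub> h) = (\<Oplus>\<^bsub>P\<^esub>x\<in>?B. (f \<oplus>\<^bsub>M\<^esub> h) x \<odot>\<^bsub>P\<^esub> g x)"
      by (rule eq) (use B s f h in auto)
    also have "\<dots> = (\<Oplus>\<^bsub>P\<^esub>x\<in>?B. f x \<odot>\<^bsub>P\<^esub> g x \<oplus>\<^bsub>P\<^esub> h x \<odot>\<^bsub>P\<^esub> g x)"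
      by (rule P.finsum_cong')
        (use B in \<open>auto simp: add_apply P.smult_l_distr coeff_closed f h g subset_eq\<close>)
    also have "\<dots> = (\<Oplus>\<^bsub>P\<^esub>x\<in>?B. f x \<odot>\<^bsub>P\<^esub> g x) \<oplus>\<^bsub>P\<^esub> (\<Oplus>\<^bsub>P\<^esub>x\<in>?B. h x \<odot>\<^bsub>P\<^esub> g x)"
      by (rule P.finsum_addf) (use B in \<open>auto simp: coeff_closed f h g subset_eq\<close>)
    also have "(\<Oplus>\<^bsub>P\<^esub>x\<in>?B. f x \<odot>\<^bsub>P\<^esub> g x) = linear_extension K P g f"
      by (rule eq[symmetric]) (use B f in auto)
    also have "(\<Oplus>\<^bsub>P\<^esub>x\<in>?B. h x \<odot>\<^bsub>P\<^esub> g x) = linear_extension K P g h"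
      by (rule eq[symmetric]) (use B h in auto)
    finally show "linear_extension K P g (f \<oplus>\<^bsub>M\<^esub> h) =
      linear_extension K P g f \<oplus>\<^bsub>P\<^esub> linear_extension K P g h" .
  next
    fix c f assume c: "c \<in> carrier K" and f: "f \<in> carrier M"
    let ?B = "{x. f x \<noteq> \<zero>\<^bsub>K\<^esub>}"
    have B: "finite ?B" "?B \<subseteq> X" using supp f finite_support by auto
    have "linear_extension K P g (c \<odot>\<^bsub>M\<^esub> f) = (\<Oplus>\<^bsub>P\<^esub>x\<in>?B. (c \<odot>\<^bsub>M\<^esub> f) x \<odot>\<^bsub>P\<^esub> g x)"
      by (rule eq) (use B c f in \<open>auto simp: smult_apply smult_mem\<close>)
    also have "\<dots> = (\<Oplus>\<^bsub>P\<^esub>x\<in>?B. c \<odot>\<^bsub>P\<^esub> (f x \<odot>\<^bsub>P\<^esub> g x))"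
      by (rule P.finsum_cong')
        (use B c in \<open>auto simp: smult_apply P.smult_assoc1 coeff_closed f g subset_eq\<close>)
    also have "\<dots> = c \<odot>\<^bsub>P\<^esub> (\<Oplus>\<^bsub>P\<^esub>x\<in>?B. f x \<odot>\<^bsub>P\<^esub> g x)"
      by (rule P.finsum_smult_ldistr[symmetric])
        (use B c in \<open>auto simp: coeff_closed f g subset_eq\<close>)
    also have "(\<Oplus>\<^bsub>P\<^esub>x\<in>?B. f x \<odot>\<^bsub>P\<^esub> g x) = linear_extension K P g f"
      by (rule eq[symmetric]) (use B f in auto)
    finally show "linear_extension K P g (c \<odot>\<^bsub>M\<^esub> f) = c \<odot>\<^bsub>P\<^esub> linear_extension K P g f" .
  qed
qed

lemma linear_extension_single:
  assumes P: "module K P" and g: "\<And>x. x \<in> X \<Longrightarrow> g x \<in> carrier P" and x: "x \<in> X"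
  shows "linear_extension K P g (single K x) = g x"
proof -
  interpret P: module K P by fact
  \<comment> \<open>The sum over \<open>{x}\<close> instead of the support also covers \<open>\<one> = \<zero>\<close>, where the support is empty.\<close>
  have "linear_extension K P g (single K x) = (\<Oplus>\<^bsub>P\<^esub>y\<in>{x}. single K x y \<odot>\<^bsub>P\<^esub> g y)"
    by (rule linear_extension_eq_finsum[OF P g single_closed[OF x]])
      (use x in \<open>auto simp: single_def\<close>)
  also have "\<dots> = g x"
    using x g by (simp add: single_def P.finsum_insert P.finsum_empty)
  finally show ?thesis .
qed

end

lemma free_on_free_module: "cring K \<Longrightarrow> free_on K X (free_module K X)"
  by (simp add: free_on_def free_on_axioms_def)

lemma free_on_free_nonassoc_algebra:
  "cring K \<Longrightarrow> free_on K {t. set_magma t \<subseteq> X} (free_nonassoc_algebra K X)"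
  by (simp add: free_on_def free_on_axioms_def free_nonassoc_algebra_def)

lemma free_on_free_assoc_algebra: "cring K \<Longrightarrow> free_on K (lists X) (free_assoc_algebra K X)"
  by (simp add: free_on_def free_on_axioms_def free_assoc_algebra_def)


section \<open>The two free algebras\<close>

lemma mult_free_nonassoc_algebra:
  "f \<otimes>\<^bsub>free_nonassoc_algebra K X\<^esub> g =
     (\<lambda>t. case t of Gen v \<Rightarrow> \<zero>\<^bsub>K\<^esub> | Node r s \<Rightarrow> f r \<otimes>\<^bsub>K\<^esub> g s)"
  by (simp add: free_nonassoc_algebra_def)

lemma nonassoc_algebra_free_nonassoc_algebra:
  assumes K: "cring K" shows "nonassoc_algebra K (free_nonassoc_algebra K X)"
proof -
  interpret free_on K "{t. set_magma t \<subseteq> X}" "free_nonassoc_algebra K X"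
    by (rule free_on_free_nonassoc_algebra[OF K])
  let ?A = "free_nonassoc_algebra K X"
  have closed: "f \<otimes>\<^bsub>?A\<^esub> g \<in> carrier ?A" if f: "f \<in> carrier ?A" and g: "g \<in> carrier ?A" for f g
  proof -
    have "{t. (f \<otimes>\<^bsub>?A\<^esub> g) t \<noteq> \<zero>\<^bsub>K\<^esub>} \<subseteq>
        (\<lambda>(r, s). Node r s) ` ({t. f t \<noteq> \<zero>\<^bsub>K\<^esub>} \<times> {t. g t \<noteq> \<zero>\<^bsub>K\<^esub>})"
    proof
      fix t assume "t \<in> {t. (f \<otimes>\<^bsub>?A\<^esub> g) t \<noteq> \<zero>\<^bsub>K\<^esub>}"
      then show "t \<in> (\<lambda>(r, s). Node r s) ` ({t. f t \<noteq> \<zero>\<^bsub>K\<^esub>} \<times> {t. g t \<noteq> \<zero>\<^bsub>K\<^esub>})"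
        using coeff_closed[OF f] coeff_closed[OF g]
        by (cases t) (auto simp: mult_free_nonassoc_algebra image_iff)
    qed
    then have "finite {t. (f \<otimes>\<^bsub>?A\<^esub> g) t \<noteq> \<zero>\<^bsub>K\<^esub>}"
      by (rule finite_subset) (intro finite_imageI finite_cartesian_product finite_support f g)
    moreover have "(f \<otimes>\<^bsub>?A\<^esub> g) t = \<zero>\<^bsub>K\<^esub>" if "\<not> set_magma t \<subseteq> X" for t
    proof (cases t)
      case (Node r s)
      then have "f r = \<zero>\<^bsub>K\<^esub> \<or> g s = \<zero>\<^bsub>K\<^esub>"
        using that coeff_outside[OF f, of r] coeff_outside[OF g, of s] by auto
      then show ?thesis
        using Node coeff_closed[OF f] coeff_closed[OF g] by (auto simp: mult_free_nonassoc_algebra)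
    qed (simp add: mult_free_nonassoc_algebra)
    moreover have "(f \<otimes>\<^bsub>?A\<^esub> g) t \<in> carrier K" for t
      using coeff_closed[OF f] coeff_closed[OF g]
      by (cases t) (simp_all add: mult_free_nonassoc_algebra)
    ultimately show ?thesis by (simp add: carrier_iff)
  qed
  show ?thesis
    by (intro nonassoc_algebra.intro nonassoc_algebra_axioms.intro module_axioms linear_mapI closed)
      (auto simp: mult_free_nonassoc_algebra add_apply smult_apply fun_eq_iff coeff_closed
        K.l_distr K.r_distr K.m_ac split: magma.split)
qed

lemma single_mult_single_magma:
  assumes "cring K"
  shows "single K r \<otimes>\<^bsub>free_nonassoc_algebra K X\<^esub> single K s = single K (Node r s)"
proof -
  interpret cring K by fact
  show ?thesis
    by (auto simp: mult_free_nonassoc_algebra single_def fun_eq_iff split: magma.split)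
qed

lemma mult_free_assoc_algebra:
  "f \<otimes>\<^bsub>free_assoc_algebra K X\<^esub> g =
     (\<lambda>w. \<Oplus>\<^bsub>K\<^esub>i\<in>{..length w}. f (take i w) \<otimes>\<^bsub>K\<^esub> g (drop i w))"
  and one_free_assoc_algebra: "\<one>\<^bsub>free_assoc_algebra K X\<^esub> = single K []"
  by (simp_all add: free_assoc_algebra_def)

lemma single_mult_single_word:
  assumes "cring K"
  shows "single K u \<otimes>\<^bsub>free_assoc_algebra K X\<^esub> single K v = single K (u @ v)"
proof
  interpret cring K by fact
  fix w
  have "(single K u \<otimes>\<^bsub>free_assoc_algebra K X\<^esub> single K v) w =
    (\<Oplus>\<^bsub>K\<^esub>i\<in>{..length w}. if length u = i then single K (u @ v) w else \<zero>\<^bsub>K\<^esub>)"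
    unfolding mult_free_assoc_algebra
  proof (rule finsum_cong')
    fix i assume "i \<in> {..length w}"
    then show "single K u (take i w) \<otimes>\<^bsub>K\<^esub> single K v (drop i w) =
        (if length u = i then single K (u @ v) w else \<zero>\<^bsub>K\<^esub>)"
      by (auto simp: single_def append_eq_conv_conj)
  qed (auto simp: single_def)
  also have "\<dots> = single K (u @ v) w"
  proof (cases "length u \<le> length w")
    case True
    then show ?thesis
      using finsum_singleton[of "length u" "{..length w}" "\<lambda>_. single K (u @ v) w"]
      by (simp add: single_def)
  next
    case False
    then have "single K (u @ v) w = \<zero>\<^bsub>K\<^esub>" by (auto simp: single_def)
    then have "(if length u = i then single K (u @ v) w else \<zero>\<^bsub>K\<^esub>) = \<zero>\<^bsub>K\<^esub>" for i by simp
    then show ?thesis using \<open>single K (u @ v) w = \<zero>\<^bsub>K\<^esub>\<close> by (simp only: finsum_zero)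
  qed
  finally show "(single K u \<otimes>\<^bsub>free_assoc_algebra K X\<^esub> single K v) w = single K (u @ v) w" .
qed

lemma nonassoc_algebra_free_assoc_algebra:
  assumes K: "cring K" shows "nonassoc_algebra K (free_assoc_algebra K X)"
proof -
  interpret free_on K "lists X" "free_assoc_algebra K X"
    by (rule free_on_free_assoc_algebra[OF K])
  let ?T = "free_assoc_algebra K X"
  have closed: "f \<otimes>\<^bsub>?T\<^esub> g \<in> carrier ?T" if f: "f \<in> carrier ?T" and g: "g \<in> carrier ?T" for f g
  proof -
    have supp: "\<exists>u v. w = u @ v \<and> f u \<noteq> \<zero>\<^bsub>K\<^esub> \<and> g v \<noteq> \<zero>\<^bsub>K\<^esub>"
      if "(f \<otimes>\<^bsub>?T\<^esub> g) w \<noteq> \<zero>\<^bsub>K\<^esub>" for w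
    proof (rule ccontr)
      assume "\<not> ?thesis"
      then have "f (take i w) \<otimes>\<^bsub>K\<^esub> g (drop i w) = \<zero>\<^bsub>K\<^esub>" for i
        using coeff_closed[OF f] coeff_closed[OF g]
        by (metis append_take_drop_id K.l_null K.r_null)
      then show False using that by (simp add: mult_free_assoc_algebra K.finsum_zero)
    qed
    then have "{w. (f \<otimes>\<^bsub>?T\<^esub> g) w \<noteq> \<zero>\<^bsub>K\<^esub>} \<subseteq>
        (\<lambda>(u, v). u @ v) ` ({w. f w \<noteq> \<zero>\<^bsub>K\<^esub>} \<times> {w. g w \<noteq> \<zero>\<^bsub>K\<^esub>})"
      by fastforce
    then have "finite {w. (f \<otimes>\<^bsub>?T\<^esub> g) w \<noteq> \<zero>\<^bsub>K\<^esub>}"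
      by (rule finite_subset) (intro finite_imageI finite_cartesian_product finite_support f g)
    moreover have "(f \<otimes>\<^bsub>?T\<^esub> g) w = \<zero>\<^bsub>K\<^esub>" if "w \<notin> lists X" for w
      using supp[of w] that coeff_outside[OF f] coeff_outside[OF g]
      by (metis append_in_lists_conv)
    moreover have "(f \<otimes>\<^bsub>?T\<^esub> g) w \<in> carrier K" for w
      using coeff_closed[OF f] coeff_closed[OF g]
      by (auto simp: mult_free_assoc_algebra intro!: K.finsum_closed)
    ultimately show ?thesis by (simp add: carrier_iff)
  qed
  show ?thesis
  proof (intro nonassoc_algebra.intro nonassoc_algebra_axioms.intro module_axioms linear_mapI closed)
    fix f g h assume f: "f \<in> carrier ?T" and g: "g \<in> carrier ?T" and h: "h \<in> carrier ?T"
    note c = coeff_closed[OF f] coeff_closed[OF g] coeff_closed[OF h]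
    show "(g \<oplus>\<^bsub>?T\<^esub> h) \<otimes>\<^bsub>?T\<^esub> f = (g \<otimes>\<^bsub>?T\<^esub> f) \<oplus>\<^bsub>?T\<^esub> (h \<otimes>\<^bsub>?T\<^esub> f)"
      by (simp add: mult_free_assoc_algebra add_apply K.l_distr K.finsum_addf c)
    show "f \<otimes>\<^bsub>?T\<^esub> (g \<oplus>\<^bsub>?T\<^esub> h) = (f \<otimes>\<^bsub>?T\<^esub> g) \<oplus>\<^bsub>?T\<^esub> (f \<otimes>\<^bsub>?T\<^esub> h)"
      by (simp add: mult_free_assoc_algebra add_apply K.r_distr K.finsum_addf c)
  next
    fix f g c assume f: "f \<in> carrier ?T" and g: "g \<in> carrier ?T" and c: "c \<in> carrier K"
    note cf = coeff_closed[OF f] coeff_closed[OF g] c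
    show "(c \<odot>\<^bsub>?T\<^esub> g) \<otimes>\<^bsub>?T\<^esub> f = c \<odot>\<^bsub>?T\<^esub> (g \<otimes>\<^bsub>?T\<^esub> f)"
      by (simp add: mult_free_assoc_algebra smult_apply K.m_assoc K.finsum_rdistr cf)
    show "f \<otimes>\<^bsub>?T\<^esub> (c \<odot>\<^bsub>?T\<^esub> g) = c \<odot>\<^bsub>?T\<^esub> (f \<otimes>\<^bsub>?T\<^esub> g)"
      by (simp add: mult_free_assoc_algebra smult_apply K.m_lcomm[of _ c] K.finsum_rdistr cf)
  qed
qed

text \<open>
  Associativity and the unit laws are multilinear, and basis elements multiply by concatenation.
\<close>

lemma assoc_algebra_free_assoc_algebra:
  assumes K: "cring K" shows "assoc_algebra K (free_assoc_algebra K X)"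
proof -
  interpret F: free_on K "lists X" "free_assoc_algebra K X"
    by (rule free_on_free_assoc_algebra[OF K])
  interpret nonassoc_algebra K "free_assoc_algebra K X"
    by (rule nonassoc_algebra_free_assoc_algebra[OF K])
  let ?T = "free_assoc_algebra K X"
  note lin = linear_map_mult_left linear_map_mult_right linear_map_id mult_closed F.single_closed
  note ext = F.linear_map_eq_on_basis[OF _ _ F.module_axioms]
  note [simp] = single_mult_single_word[OF K]
  have 1: "(single K u \<otimes>\<^bsub>?T\<^esub> single K v) \<otimes>\<^bsub>?T\<^esub> h = single K u \<otimes>\<^bsub>?T\<^esub> (single K v \<otimes>\<^bsub>?T\<^esub> h)"
    if "u \<in> lists X" "v \<in> lists X" "h \<in> carrier ?T" for u v h
    by (rule ext[where f = "\<lambda>h. (single K u \<otimes>\<^bsub>?T\<^esub> single K v) \<otimes>\<^bsub>?T\<^esub> h", OF _ _ _ that(3)])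
      (intro lin that | simp)+
  have 2: "(single K u \<otimes>\<^bsub>?T\<^esub> g) \<otimes>\<^bsub>?T\<^esub> h = single K u \<otimes>\<^bsub>?T\<^esub> (g \<otimes>\<^bsub>?T\<^esub> h)"
    if "u \<in> lists X" "g \<in> carrier ?T" "h \<in> carrier ?T" for u g h
    by (rule ext[where f = "\<lambda>g. (single K u \<otimes>\<^bsub>?T\<^esub> g) \<otimes>\<^bsub>?T\<^esub> h", OF _ _ _ that(2)])
      (intro lin that 1)+
  show ?thesis
  proof (rule assoc_algebraI)
    fix f g h assume f: "f \<in> carrier ?T" and gh: "g \<in> carrier ?T" "h \<in> carrier ?T"
    show "(f \<otimes>\<^bsub>?T\<^esub> g) \<otimes>\<^bsub>?T\<^esub> h = f \<otimes>\<^bsub>?T\<^esub> (g \<otimes>\<^bsub>?T\<^esub> h)"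
      by (rule ext[where f = "\<lambda>f. (f \<otimes>\<^bsub>?T\<^esub> g) \<otimes>\<^bsub>?T\<^esub> h", OF _ _ _ f])
        (intro lin gh 2)+
  next
    show one: "\<one>\<^bsub>?T\<^esub> \<in> carrier ?T" by (simp add: one_free_assoc_algebra F.single_closed)
    fix f assume f: "f \<in> carrier ?T"
    show "\<one>\<^bsub>?T\<^esub> \<otimes>\<^bsub>?T\<^esub> f = f"
      by (rule ext[where f = "\<lambda>f. \<one>\<^bsub>?T\<^esub> \<otimes>\<^bsub>?T\<^esub> f", OF _ _ _ f])
        (intro lin one | simp add: one_free_assoc_algebra)+
    show "f \<otimes>\<^bsub>?T\<^esub> \<one>\<^bsub>?T\<^esub> = f"
      by (rule ext[where f = "\<lambda>f. f \<otimes>\<^bsub>?T\<^esub> \<one>\<^bsub>?T\<^esub>", OF _ _ _ f])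
        (intro lin one | simp add: one_free_assoc_algebra)+
  qed
qed


section \<open>The enveloping algebra\<close>

text \<open>
  The enveloping algebra \<open>U\<close> of \<open>G\<close>. The Lie axioms are not assumed of the product of \<open>G\<close>:
  the construction and the facts below need
  a product only as a map into \<open>carrier G\<close>.
\<close>

locale enveloping = G: module K G
  for K :: "('k, 'r) ring_scheme" and G :: "('k, 'g, 's) module_scheme" +
  assumes bracket_closed: "\<lbrakk>a \<in> carrier G; b \<in> carrier G\<rbrakk> \<Longrightarrow> a \<otimes>\<^bsub>G\<^esub> b \<in> carrier G"
begin

abbreviation T :: "('k, 'g list \<Rightarrow> 'k) module" where "T \<equiv> free_assoc_algebra K (carrier G)"

abbreviation U :: "('k, ('g list \<Rightarrow> 'k) set) module" where "U \<equiv> enveloping_algebra K G"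

abbreviation gen :: "'g \<Rightarrow> 'g list \<Rightarrow> 'k" where "gen a \<equiv> single K [a]"

text \<open>The relators between the generators of the enveloping algebra, in the free algebra \<open>T\<close>.\<close>

definition relators :: "('g list \<Rightarrow> 'k) set" where
  "relators = linear_relators K G T gen \<union>
    {(gen a \<otimes>\<^bsub>T\<^esub> gen b \<ominus>\<^bsub>T\<^esub> gen b \<otimes>\<^bsub>T\<^esub> gen a) \<ominus>\<^bsub>T\<^esub> gen (a \<otimes>\<^bsub>G\<^esub> b) |
     a b. a \<in> carrier G \<and> b \<in> carrier G}"

text \<open>The kernel of the projection from \<open>T\<close> to the enveloping algebra.\<close>

definition J :: "('g list \<Rightarrow> 'k) set" where "J = Idl\<^bsub>T\<^esub> relators"

sublocale F: free_on K "lists (carrier G)" T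
  by (rule free_on_free_assoc_algebra[OF G.R.is_cring])

sublocale T: assoc_algebra K T
  by (rule assoc_algebra_free_assoc_algebra[OF G.R.is_cring])

lemma gen_closed: "a \<in> carrier G \<Longrightarrow> gen a \<in> carrier T"
  by (rule F.single_closed) simp

lemma relators_subset: "relators \<subseteq> carrier T"
  using linear_relators_subset[OF G.module_axioms F.module_axioms gen_closed]
  by (auto simp: relators_def gen_closed bracket_closed)

lemma ideal_J: "ideal J T"
  unfolding J_def by (rule T.genideal_ideal[OF relators_subset])

lemma J_subset:
  assumes "ideal N T" and "relators \<subseteq> N" shows "J \<subseteq> N"
  unfolding J_def by (rule T.genideal_minimal[OF assms])

lemma submodule_ideal:
  assumes "ideal N T" shows "submodule N K T"
proof -
  interpret N: ideal N T by fact
  show ?thesis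
  proof (intro submodule.intro submodule_axioms.intro N.a_subgroup)
    fix c x assume c: "c \<in> carrier K" and x: "x \<in> N"
    have "(c \<odot>\<^bsub>T\<^esub> \<one>\<^bsub>T\<^esub>) \<otimes>\<^bsub>T\<^esub> x = c \<odot>\<^bsub>T\<^esub> x"
      using c N.a_Hcarr[OF x] by (simp add: T.smult_mult_left)
    then show "c \<odot>\<^bsub>T\<^esub> x \<in> N"
      using c x N.I_l_closed[of x "c \<odot>\<^bsub>T\<^esub> \<one>\<^bsub>T\<^esub>"] by simp
  qed
qed

sublocale Q: quotient_nonassoc_algebra K T J
proof -
  interpret ideal J T by (rule ideal_J)
  show "quotient_nonassoc_algebra K T J"
    by (intro quotient_nonassoc_algebra.intro quotient_module.intro quotient_module_axioms.intro
        quotient_nonassoc_algebra_axioms.intro T.nonassoc_algebra_axioms F.module_axioms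
        submodule_ideal ideal_J I_l_closed I_r_closed)
qed

lemma quotient_eq_U: "quotient_algebra T J = U"
  unfolding enveloping_algebra_def J_def relators_def Let_def ..

text \<open>
  The product in the enveloping algebra of the letters of a word; \<open>word [a]\<close> is the image of \<open>a\<close>.
\<close>

abbreviation word :: "'g list \<Rightarrow> ('g list \<Rightarrow> 'k) set" where "word w \<equiv> Q.cls (single K w)"

lemmas U_cases = Q.quotient_cases[unfolded quotient_eq_U]
lemmas cls_closed = Q.cls_closed[unfolded quotient_eq_U]
lemmas mult_cls = Q.mult_cls[unfolded quotient_eq_U]
lemmas linear_cls = Q.linear_cls[unfolded quotient_eq_U]
lemmas module_U = Q.module_quotient[unfolded quotient_eq_U]

lemma assoc_algebra_U: "assoc_algebra K U"
  unfolding quotient_eq_U[symmetric]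
  by (rule nonassoc_algebra.assoc_algebraI[OF Q.nonassoc_algebra_quotient])
    (auto elim!: Q.quotient_cases
      simp: Q.mult_cls Q.one_quotient Q.cls_closed T.m_assoc T.mult_closed)

lemma word_closed: "w \<in> lists (carrier G) \<Longrightarrow> word w \<in> carrier U"
  by (simp add: cls_closed F.single_closed)

lemma word_Nil: "word [] = \<one>\<^bsub>U\<^esub>"
  using Q.one_quotient by (simp add: quotient_eq_U one_free_assoc_algebra)

lemma word_append:
  "\<lbrakk>u \<in> lists (carrier G); v \<in> lists (carrier G)\<rbrakk> \<Longrightarrow> word (u @ v) = word u \<otimes>\<^bsub>U\<^esub> word v"
  by (simp add: mult_cls F.single_closed single_mult_single_word[OF G.R.is_cring])

lemma linear_word_single: "linear_map K G U (\<lambda>a. word [a])"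
proof -
  have "linear_relators K G T gen \<subseteq> J"
    using T.genideal_self[OF relators_subset] by (auto simp: J_def relators_def)
  from Q.linear_cls_relators[OF G.module_axioms gen_closed this]
  show ?thesis by (simp add: quotient_eq_U)
qed

lemma word_commutator:
  assumes a: "a \<in> carrier G" and b: "b \<in> carrier G"
  shows "word [a] \<otimes>\<^bsub>U\<^esub> word [b] \<ominus>\<^bsub>U\<^esub> word [b] \<otimes>\<^bsub>U\<^esub> word [a] = word [a \<otimes>\<^bsub>G\<^esub> b]"
proof -
  let ?c = "gen a \<otimes>\<^bsub>T\<^esub> gen b \<ominus>\<^bsub>T\<^esub> gen b \<otimes>\<^bsub>T\<^esub> gen a"
  have "?c \<ominus>\<^bsub>T\<^esub> gen (a \<otimes>\<^bsub>G\<^esub> b) \<in> J"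
    using T.genideal_self[OF relators_subset] a b by (auto simp: J_def relators_def)
  then have "Q.cls ?c = word [a \<otimes>\<^bsub>G\<^esub> b]"
    using a b by (simp add: Q.cls_eq_iff gen_closed T.mult_closed bracket_closed)
  moreover have "Q.cls ?c = word [a] \<otimes>\<^bsub>U\<^esub> word [b] \<ominus>\<^bsub>U\<^esub> word [b] \<otimes>\<^bsub>U\<^esub> word [a]"
    using a b by (simp add: linear_map_diff[OF linear_cls F.module_axioms module_U] mult_cls
        gen_closed T.mult_closed)
  ultimately show ?thesis by simp
qed

lemma linear_map_eq_on_words:
  assumes f: "linear_map K U P f" and g: "linear_map K U P g" and P: "module K P"
    and eq: "\<And>w. w \<in> lists (carrier G) \<Longrightarrow> f (word w) = g (word w)" and u: "u \<in> carrier U"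
  shows "f u = g u"
proof -
  from u obtain x where x: "x \<in> carrier T" "u = Q.cls x" by (rule U_cases)
  have "f (Q.cls x) = g (Q.cls x)"
    using linear_map_compose[OF linear_cls f] linear_map_compose[OF linear_cls g] P eq x(1)
    by (rule F.linear_map_eq_on_basis)
  with x show ?thesis by simp
qed

text \<open>
  Since \<open>G\<close> generates the enveloping algebra, a linear map that commutes with the action of \<open>G\<close> is
  a morphism of modules over it.
\<close>

lemma equivariant_on_generators:
  assumes M: "right_module K U M act" and M': "right_module K U M' act'"
    and h: "linear_map K M M' h"
    and eq: "\<And>x a. \<lbrakk>x \<in> carrier M; a \<in> carrier G\<rbrakk> \<Longrightarrow> h (act x (word [a])) = act' (h x) (word [a])"
    and x: "x \<in> carrier M" and u: "u \<in> carrier U"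
  shows "h (act x u) = act' (h x) u"
proof -
  interpret M: right_module K U M act by fact
  interpret M': right_module K U M' act' by fact
  note hc = linear_map_closed[OF h]
  have act: "linear_map K U M (act y)" if "y \<in> carrier M" for y
    using that by (intro linear_mapI) (simp_all add: M.act_closed M.act_add_right M.act_smult_right)
  have act': "linear_map K U M' (act' y)" if "y \<in> carrier M'" for y
    using that by (intro linear_mapI) (simp_all add: M'.act_closed M'.act_add_right M'.act_smult_right)
  show ?thesis
  proof (rule linear_map_eq_on_words[OF linear_map_compose[OF act h] act' M'.M.module_axioms _ u])
    fix w assume "w \<in> lists (carrier G)"
    then show "h (act x (word w)) = act' (h x) (word w)"
    proof (induction w rule: rev_induct)
      case Nil
      then show ?case using x hc by (simp add: word_Nil M.act_one M'.act_one)
    next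
      case (snoc a w)
      then have "w \<in> lists (carrier G)" "[a] \<in> lists (carrier G)" "a \<in> carrier G" by auto
      with snoc.IH x show ?case
        by (simp add: word_append word_closed M.act_mult M'.act_mult eq M.act_closed hc)
    qed
  qed (use x hc in auto)
qed

end


section \<open>Pre-Lie algebras as modules over their enveloping algebra\<close>

text \<open>The right-symmetric convention: the associator is symmetric in its last two arguments.\<close>

locale pre_Lie_algebra = nonassoc_algebra K L
  for K :: "('k, 'r) ring_scheme" and L :: "('k, 'l, 's) module_scheme" +
  assumes pre_Lie: "\<lbrakk>x \<in> carrier L; y \<in> carrier L; z \<in> carrier L\<rbrakk> \<Longrightarrow>
    (x \<otimes>\<^bsub>L\<^esub> y) \<otimes>\<^bsub>L\<^esub> z \<ominus>\<^bsub>L\<^esub> x \<otimes>\<^bsub>L\<^esub> (y \<otimes>\<^bsub>L\<^esub> z) =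
    (x \<otimes>\<^bsub>L\<^esub> z) \<otimes>\<^bsub>L\<^esub> y \<ominus>\<^bsub>L\<^esub> x \<otimes>\<^bsub>L\<^esub> (z \<otimes>\<^bsub>L\<^esub> y)"
begin

abbreviation G :: "('k, 'l, 's) module_scheme" where "G \<equiv> Lie_of L"

lemma carrier_Lie_of: "carrier G = carrier L"
  by (simp add: Lie_of_def)

lemma mem_Lie_of [simp]: "x \<in> carrier G \<longleftrightarrow> x \<in> carrier L"
  by (simp add: Lie_of_def)

lemma Lie_of_simps [simp]:
  "zero G = zero L" "add G = add L" "smult G = smult L"
  "a \<otimes>\<^bsub>G\<^esub> b = a \<otimes>\<^bsub>L\<^esub> b \<ominus>\<^bsub>L\<^esub> b \<otimes>\<^bsub>L\<^esub> a"
  by (simp_all add: Lie_of_def)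

lemma linear_map_Lie_of_iff: "linear_map K G P f \<longleftrightarrow> linear_map K L P f"
  by (simp add: linear_map_def carrier_Lie_of)

lemma module_Lie_of: "module K G"
proof (rule moduleI)
  show "abelian_group G"
    by (rule comm_group_abelian_groupI) (use M.a_comm_group in \<open>simp add: carrier_Lie_of\<close>)
qed (auto simp: smult_l_distr smult_r_distr smult_assoc1 R.is_cring)

sublocale E: enveloping K G
  by (intro enveloping.intro enveloping_axioms.intro module_Lie_of) (simp add: mult_closed)

text \<open>
  The action of the free associative algebra \<open>T\<close> on \<open>L\<close> by iterated right multiplication, from
  which \<open>pre_Lie_action\<close> is obtained by passing to the quotient.
\<close>

definition word_action :: "'l \<Rightarrow> ('l list \<Rightarrow> 'k) \<Rightarrow> 'l" where
  "word_action l = linear_extension K L (foldl (\<lambda>x a. x \<otimes>\<^bsub>L\<^esub> a) l)"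

lemma linear_foldl:
  "w \<in> lists (carrier G) \<Longrightarrow> linear_map K L L (\<lambda>l. foldl (\<lambda>x a. x \<otimes>\<^bsub>L\<^esub> a) l w)"
proof (induction w rule: rev_induct)
  case (snoc a w)
  then show ?case using linear_map_mult_left[of L "\<lambda>l. foldl (\<lambda>x a. x \<otimes>\<^bsub>L\<^esub> a) l w" a] by simp
qed (simp add: linear_map_id)

lemma foldl_closed:
  "\<lbrakk>w \<in> lists (carrier G); l \<in> carrier L\<rbrakk> \<Longrightarrow> foldl (\<lambda>x a. x \<otimes>\<^bsub>L\<^esub> a) l w \<in> carrier L"
  using linear_map_closed[OF linear_foldl] by simp

lemma linear_word_action: "l \<in> carrier L \<Longrightarrow> linear_map K E.T L (word_action l)"
  unfolding word_action_def by (rule E.F.linear_linear_extension[OF module_axioms foldl_closed])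

lemma word_action_single:
  "\<lbrakk>w \<in> lists (carrier G); l \<in> carrier L\<rbrakk> \<Longrightarrow>
     word_action l (single K w) = foldl (\<lambda>x a. x \<otimes>\<^bsub>L\<^esub> a) l w"
  unfolding word_action_def by (rule E.F.linear_extension_single[OF module_axioms foldl_closed])

lemma linear_word_action_left:
  assumes "f \<in> carrier E.T" shows "linear_map K L L (\<lambda>l. word_action l f)"
  using assms
proof (induction rule: E.F.free_induct)
  case zero
  show ?case
    by (rule linear_map_cong[OF linear_map_const_zero[OF module_axioms] module_axioms])
      (simp add: linear_map_zero[OF linear_word_action E.F.module_axioms module_axioms])
next
  case (step c w g)
  have "linear_map K L L (\<lambda>l. word_action l g \<oplus>\<^bsub>L\<^esub> c \<odot>\<^bsub>L\<^esub> foldl (\<lambda>x a. x \<otimes>\<^bsub>L\<^esub> a) l w)"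
    using step by (intro linear_map_sum linear_map_scale linear_foldl module_axioms) simp_all
  then show ?case
    by (rule linear_map_cong[OF _ module_axioms])
      (use step in \<open>simp add: linear_map_add[OF linear_word_action]
        linear_map_smult[OF linear_word_action] word_action_single E.F.single_closed\<close>)
qed

lemma word_action_mult:
  assumes l: "l \<in> carrier L" and f: "f \<in> carrier E.T" and g: "g \<in> carrier E.T"
  shows "word_action l (f \<otimes>\<^bsub>E.T\<^esub> g) = word_action (word_action l f) g"
proof -
  have 1: "word_action l (single K u \<otimes>\<^bsub>E.T\<^esub> g) = word_action (word_action l (single K u)) g"
    if u: "u \<in> lists (carrier G)" for u
  proof (rule E.F.linear_map_eq_on_basis[OF linear_map_compose[OF E.T.mult_linear_right
          linear_word_action[OF l]] linear_word_action module_axioms _ g])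
    show "single K u \<in> carrier E.T" using u by (rule E.F.single_closed)
    show "word_action l (single K u) \<in> carrier L"
      using linear_map_closed[OF linear_word_action[OF l]] u E.F.single_closed by blast
    fix v assume "v \<in> lists (carrier G)"
    with u l show "word_action l (single K u \<otimes>\<^bsub>E.T\<^esub> single K v) =
        word_action (word_action l (single K u)) (single K v)"
      by (simp add: single_mult_single_word[OF R.is_cring] word_action_single foldl_closed)
  qed
  show ?thesis
    by (rule E.F.linear_map_eq_on_basis[OF linear_map_compose[OF E.T.mult_linear_left[OF g]
          linear_word_action[OF l]] linear_map_compose[OF linear_word_action[OF l]
            linear_word_action_left[OF g]] module_axioms 1 f])
qed

text \<open>
  The elements of \<open>T\<close> that annihilate \<open>L\<close> form a two-sided ideal, and the pre-Lie identity is exactly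
  what puts the commutator relators into it.
\<close>

lemma word_action_J:
  assumes "f \<in> E.J" and l: "l \<in> carrier L"
  shows "word_action l f = \<zero>\<^bsub>L\<^esub>"
proof -
  define N where "N = {f \<in> carrier E.T. \<forall>l\<in>carrier L. word_action l f = \<zero>\<^bsub>L\<^esub>}"
  note wa = linear_mapD[OF linear_word_action] linear_map_diff[OF linear_word_action E.F.module_axioms module_axioms]
    linear_map_zero[OF linear_word_action E.F.module_axioms module_axioms]
    linear_map_minus[OF linear_word_action E.F.module_axioms module_axioms]
  have "ideal N E.T"
  proof (rule idealI)
    show "ring E.T" by (rule E.T.ring_axioms)
    have "submodule N K E.T"
      by (rule E.F.submoduleI) (auto simp: N_def wa)
    then show "subgroup N (add_monoid E.T)" by (rule submodule.axioms(1))
  qed (auto simp: N_def word_action_mult wa E.T.mult_closed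
      linear_map_zero[OF linear_word_action_left module_axioms module_axioms])
  moreover have "E.relators \<subseteq> N"
  proof
    fix r assume r: "r \<in> E.relators"
    have "word_action l r = \<zero>\<^bsub>L\<^esub>" if l: "l \<in> carrier L" for l
    proof -
      have gen: "word_action k (E.gen a) = k \<otimes>\<^bsub>L\<^esub> a" if "a \<in> carrier L" "k \<in> carrier L" for a k
        using word_action_single[of "[a]" k] that by simp
      have "linear_map K G L (\<lambda>a. word_action l (E.gen a))"
        unfolding linear_map_Lie_of_iff
        using linear_map_cong[OF mult_linear_right[OF l] module_axioms] gen l by metis
      then have "word_action l r = \<zero>\<^bsub>L\<^esub>" if "r \<in> linear_relators K G E.T E.gen"
        using linear_relators_vanish[OF linear_word_action[OF l] _ module_Lie_of
            E.F.module_axioms module_axioms E.gen_closed that] by simp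
      moreover have "word_action l ((E.gen a \<otimes>\<^bsub>E.T\<^esub> E.gen b \<ominus>\<^bsub>E.T\<^esub> E.gen b \<otimes>\<^bsub>E.T\<^esub> E.gen a)
          \<ominus>\<^bsub>E.T\<^esub> E.gen (a \<otimes>\<^bsub>G\<^esub> b)) = \<zero>\<^bsub>L\<^esub>"
        if a: "a \<in> carrier L" and b: "b \<in> carrier L" for a b
      proof -
        have c: "E.gen a \<in> carrier E.T" "E.gen b \<in> carrier E.T"
          "E.gen (a \<otimes>\<^bsub>L\<^esub> b \<ominus>\<^bsub>L\<^esub> b \<otimes>\<^bsub>L\<^esub> a) \<in> carrier E.T"
          using a b E.gen_closed by (simp_all add: mult_closed)
        let ?p = "(l \<otimes>\<^bsub>L\<^esub> a) \<otimes>\<^bsub>L\<^esub> b" and ?q = "(l \<otimes>\<^bsub>L\<^esub> b) \<otimes>\<^bsub>L\<^esub> a"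
        let ?r = "l \<otimes>\<^bsub>L\<^esub> (a \<otimes>\<^bsub>L\<^esub> b)" and ?s = "l \<otimes>\<^bsub>L\<^esub> (b \<otimes>\<^bsub>L\<^esub> a)"
        have cl: "?p \<in> carrier L" "?q \<in> carrier L" "?r \<in> carrier L" "?s \<in> carrier L"
          using a b l by (simp_all add: mult_closed)
        have "?p \<ominus>\<^bsub>L\<^esub> ?q = ?r \<ominus>\<^bsub>L\<^esub> ?s"
          by (rule M.minus_eq_minus_swap[OF cl pre_Lie[OF l a b]])
        then have "(?p \<ominus>\<^bsub>L\<^esub> ?q) \<ominus>\<^bsub>L\<^esub> (?r \<ominus>\<^bsub>L\<^esub> ?s) = \<zero>\<^bsub>L\<^esub>"
          using cl by (simp add: M.minus_eq_zero_iff)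
        then show ?thesis
          using a b l c by (simp add: wa word_action_mult gen E.T.mult_closed mult_closed
            linear_map_diff[OF mult_linear_right module_axioms module_axioms])
      qed
      ultimately show ?thesis using r by (auto simp: E.relators_def)
    qed
    then show "r \<in> N" using r E.relators_subset by (auto simp: N_def)
  qed
  ultimately have "E.J \<subseteq> N" by (rule E.J_subset)
  then show ?thesis using assms by (auto simp: N_def)
qed

lemma pre_Lie_action_cls:
  "\<lbrakk>l \<in> carrier L; f \<in> carrier E.T\<rbrakk> \<Longrightarrow> pre_Lie_action K L l (E.Q.cls f) = word_action l f"
  unfolding pre_Lie_action_def word_action_def[symmetric]
  by (rule E.Q.the_elem_image_cls[OF linear_word_action module_axioms word_action_J])

lemma pre_Lie_action_word_single:
  "\<lbrakk>l \<in> carrier L; a \<in> carrier L\<rbrakk> \<Longrightarrow> pre_Lie_action K L l (E.word [a]) = l \<otimes>\<^bsub>L\<^esub> a"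
  using E.gen_closed[of a] by (simp add: pre_Lie_action_cls word_action_single)

theorem right_module_pre_Lie_action: "right_module K E.U L (pre_Lie_action K L)"
proof -
  interpret U: assoc_algebra K E.U by (rule E.assoc_algebra_U)
  note lin = linear_mapD[OF linear_word_action] linear_mapD[OF linear_word_action_left]
  note cls = linear_map_add[OF E.linear_cls, symmetric] linear_map_smult[OF E.linear_cls, symmetric]
  show ?thesis
  proof unfold_locales
    fix x assume x: "x \<in> carrier L"
    then show "pre_Lie_action K L x \<one>\<^bsub>E.U\<^esub> = x"
      by (simp add: E.word_Nil[symmetric] pre_Lie_action_cls E.F.single_closed word_action_single)
  qed (auto elim!: E.U_cases simp: cls pre_Lie_action_cls lin E.mult_cls word_action_mult
      E.T.mult_closed)
qed

end


section \<open>Tensor products\<close>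

text \<open>
  The tensor product \<open>W\<close> of two modules over the same ring, with \<open>pure v u\<close> for \<open>v \<otimes> u\<close>.
\<close>

locale tensor = V: module K V + U: module K U
  for K :: "('k, 'r) ring_scheme" and V :: "('k, 'v, 's) module_scheme"
    and U :: "('k, 'u, 't) module_scheme"
begin

abbreviation F :: "('k, 'v \<times> 'u \<Rightarrow> 'k) module" where
  "F \<equiv> free_module K (carrier V \<times> carrier U)"

abbreviation W :: "('k, ('v \<times> 'u \<Rightarrow> 'k) set) module" where "W \<equiv> tensor_product K V U"

abbreviation pure :: "'v \<Rightarrow> 'u \<Rightarrow> ('v \<times> 'u \<Rightarrow> 'k) set" where "pure \<equiv> pure_tensor K V U"

text \<open>The generators of the submodule \<open>tensor_relators\<close>.\<close>

definition relators :: "('v \<times> 'u \<Rightarrow> 'k) set" where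
  "relators = (\<Union>u\<in>carrier U. linear_relators K V F (\<lambda>v. single K (v, u))) \<union>
     (\<Union>v\<in>carrier V. linear_relators K U F (\<lambda>u. single K (v, u)))"

sublocale F: free_on K "carrier V \<times> carrier U" F
  by (rule free_on_free_module[OF V.R.is_cring])

lemma tensor_relators_eq: "tensor_relators K V U = generated_submodule K F relators"
  by (simp add: tensor_relators_def relators_def Let_def)

lemma relators_subset: "relators \<subseteq> carrier F"
proof -
  have "linear_relators K V F (\<lambda>v. single K (v, u)) \<subseteq> carrier F" if "u \<in> carrier U" for u
    using that by (intro linear_relators_subset V.module_axioms F.module_axioms F.single_closed) simp
  moreover have "linear_relators K U F (\<lambda>u. single K (v, u)) \<subseteq> carrier F" if "v \<in> carrier V" for v
    using that by (intro linear_relators_subset U.module_axioms F.module_axioms F.single_closed) simp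
  ultimately show ?thesis unfolding relators_def by blast
qed

sublocale Q: quotient_module K F "tensor_relators K V U"
proof (intro quotient_module.intro quotient_module_axioms.intro F.module_axioms)
  show "submodule (tensor_relators K V U) K F"
    unfolding tensor_relators_eq generated_submodule_def
    using relators_subset F.carrier_is_submodule by (intro F.submodule_Inter) auto
qed

lemma quotient_eq_W: "quotient_algebra F (tensor_relators K V U) = W"
  by (simp add: tensor_product_def)

lemma cls_single: "Q.cls (single K (v, u)) = pure v u"
  by (simp add: pure_tensor_def)

lemmas W_cases = Q.quotient_cases[unfolded quotient_eq_W]
lemmas module_W = Q.module_quotient[unfolded quotient_eq_W]
lemmas linear_cls = Q.linear_cls[unfolded quotient_eq_W]

lemma linear_pure_left:
  assumes "u \<in> carrier U" shows "linear_map K V W (\<lambda>v. pure v u)"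
proof -
  have "linear_relators K V F (\<lambda>v. single K (v, u)) \<subseteq> tensor_relators K V U"
    using assms by (auto simp: tensor_relators_eq generated_submodule_def relators_def)
  with Q.linear_cls_relators[OF V.module_axioms _ this] assms show ?thesis
    by (simp add: F.single_closed cls_single quotient_eq_W)
qed

lemma linear_pure_right:
  assumes "v \<in> carrier V" shows "linear_map K U W (\<lambda>u. pure v u)"
proof -
  have "linear_relators K U F (\<lambda>u. single K (v, u)) \<subseteq> tensor_relators K V U"
    using assms by (auto simp: tensor_relators_eq generated_submodule_def relators_def)
  with Q.linear_cls_relators[OF U.module_axioms _ this] assms show ?thesis
    by (simp add: F.single_closed cls_single quotient_eq_W)
qed

lemma linear_map_eq_on_pure:
  assumes f: "linear_map K W P f" and g: "linear_map K W P g" and P: "module K P"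
    and eq: "\<And>v u. \<lbrakk>v \<in> carrier V; u \<in> carrier U\<rbrakk> \<Longrightarrow> f (pure v u) = g (pure v u)"
    and t: "t \<in> carrier W"
  shows "f t = g t"
proof -
  from t obtain x where x: "x \<in> carrier F" "t = Q.cls x" by (rule W_cases)
  have "f (Q.cls x) = g (Q.cls x)"
    by (rule F.linear_map_eq_on_basis[OF linear_map_compose[OF linear_cls f]
        linear_map_compose[OF linear_cls g] P _ x(1)]) (use eq in \<open>auto simp: cls_single\<close>)
  with x show ?thesis by simp
qed

text \<open>
  The universal property: a bilinear map \<open>g\<close> extends to a linear map on the tensor product.
\<close>

context
  fixes P :: "('k, 'p, 'q) module_scheme" and g :: "'v \<times> 'u \<Rightarrow> 'p"
  assumes P: "module K P"
    and left: "\<And>u. u \<in> carrier U \<Longrightarrow> linear_map K V P (\<lambda>v. g (v, u))"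
    and right: "\<And>v. v \<in> carrier V \<Longrightarrow> linear_map K U P (\<lambda>u. g (v, u))"
begin

lemma bilinear_closed: "x \<in> carrier V \<times> carrier U \<Longrightarrow> g x \<in> carrier P"
  using linear_map_closed[OF left] by auto

lemma linear_ext: "linear_map K F P (linear_extension K P g)"
  by (rule F.linear_linear_extension[OF P bilinear_closed])

lemma ext_single:
  "\<lbrakk>v \<in> carrier V; u \<in> carrier U\<rbrakk> \<Longrightarrow> linear_extension K P g (single K (v, u)) = g (v, u)"
  by (rule F.linear_extension_single[OF P bilinear_closed]) simp_all

lemma linear_extension_tensor_relators:
  assumes "x \<in> tensor_relators K V U"
  shows "linear_extension K P g x = \<zero>\<^bsub>P\<^esub>"
proof -
  let ?h = "linear_extension K P g"
  have 1: "?h r = \<zero>\<^bsub>P\<^esub>" if "u \<in> carrier U" "r \<in> linear_relators K V F (\<lambda>v. single K (v, u))" for u r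
  proof (rule linear_relators_vanish[OF linear_ext _ V.module_axioms F.module_axioms P _ that(2)])
    show "linear_map K V P (\<lambda>v. ?h (single K (v, u)))"
      by (rule linear_map_cong[OF left[OF that(1)] V.module_axioms]) (simp add: ext_single that(1))
  qed (use that(1) in \<open>auto intro: F.single_closed\<close>)
  have 2: "?h r = \<zero>\<^bsub>P\<^esub>" if "v \<in> carrier V" "r \<in> linear_relators K U F (\<lambda>u. single K (v, u))" for v r
  proof (rule linear_relators_vanish[OF linear_ext _ U.module_axioms F.module_axioms P _ that(2)])
    show "linear_map K U P (\<lambda>u. ?h (single K (v, u)))"
      by (rule linear_map_cong[OF right[OF that(1)] U.module_axioms]) (simp add: ext_single that(1))
  qed (use that(1) in \<open>auto intro: F.single_closed\<close>)
  have "relators \<subseteq> {x \<in> carrier F. ?h x = \<zero>\<^bsub>P\<^esub>}"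
    using relators_subset 1 2 by (auto simp: relators_def)
  then have "tensor_relators K V U \<subseteq> {x \<in> carrier F. ?h x = \<zero>\<^bsub>P\<^esub>}"
    unfolding tensor_relators_eq generated_submodule_def
    using submodule_kernel[OF linear_ext F.module_axioms P] by (intro Inter_lower CollectI conjI)
  with assms show ?thesis by blast
qed

lemma linear_tensor_lift: "linear_map K W P (\<lambda>t. the_elem (linear_extension K P g ` t))"
  using Q.linear_the_elem_image[OF linear_ext P linear_extension_tensor_relators]
  by (simp add: quotient_eq_W)

lemma tensor_lift_pure:
  assumes "v \<in> carrier V" and "u \<in> carrier U"
  shows "the_elem (linear_extension K P g ` pure v u) = g (v, u)"
  using Q.the_elem_image_cls[OF linear_ext P linear_extension_tensor_relators, where x = "single K (v, u)"]
    assms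
  by (simp add: ext_single F.single_closed cls_single)

end

end

text \<open>The free right module \<open>V \<otimes> U\<close> over an associative algebra \<open>U\<close>.\<close>

locale free_right_module = V: module K V + U: assoc_algebra K U
  for K :: "('k, 'r) ring_scheme" and V :: "('k, 'v, 's) module_scheme"
    and U :: "('k, 'u, 't) module_scheme"
begin

sublocale tensor K V U ..

lemma
  assumes w: "w \<in> carrier U"
  shows linear_free_action: "linear_map K W W (\<lambda>t. free_action K V U t w)"
    and free_action_pure:
      "\<lbrakk>v \<in> carrier V; u \<in> carrier U\<rbrakk> \<Longrightarrow> free_action K V U (pure v u) w = pure v (u \<otimes>\<^bsub>U\<^esub> w)"
proof -
  let ?g = "\<lambda>(v, u). pure v (u \<otimes>\<^bsub>U\<^esub> w)"
  have left: "linear_map K V W (\<lambda>v. ?g (v, u))" if "u \<in> carrier U" for u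
    using linear_pure_left[of "u \<otimes>\<^bsub>U\<^esub> w"] that w by simp
  have right: "linear_map K U W (\<lambda>u. ?g (v, u))" if "v \<in> carrier V" for v
    using linear_map_compose[OF U.mult_linear_left[OF w] linear_pure_right[OF that]] by simp
  show "linear_map K W W (\<lambda>t. free_action K V U t w)"
    unfolding free_action_def by (rule linear_tensor_lift[OF module_W left right])
  show "free_action K V U (pure v u) w = pure v (u \<otimes>\<^bsub>U\<^esub> w)"
    if "v \<in> carrier V" "u \<in> carrier U"
    unfolding free_action_def using tensor_lift_pure[OF module_W left right that] by simp
qed

theorem right_module_free_action: "right_module K U W (free_action K V U)"
proof -
  interpret W: module K W by (rule module_W)
  note lin = linear_mapD[OF linear_free_action]
  note pr = linear_mapD[OF linear_pure_right]
  show ?thesis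
  proof unfold_locales
    fix x assume x: "x \<in> carrier W"
    show "free_action K V U x \<one>\<^bsub>U\<^esub> = x"
      by (rule linear_map_eq_on_pure[OF linear_free_action linear_map_id module_W _ x])
        (simp_all add: free_action_pure)
    fix u w assume u: "u \<in> carrier U" and w: "w \<in> carrier U"
    show "free_action K V U x (u \<oplus>\<^bsub>U\<^esub> w) = free_action K V U x u \<oplus>\<^bsub>W\<^esub> free_action K V U x w"
      by (rule linear_map_eq_on_pure[OF linear_free_action
            linear_map_sum[OF linear_free_action linear_free_action module_W] module_W _ x])
        (use u w in \<open>simp_all add: free_action_pure U.r_distr pr\<close>)
    show "free_action K V U x (u \<otimes>\<^bsub>U\<^esub> w) = free_action K V U (free_action K V U x u) w"
      by (rule linear_map_eq_on_pure[OF linear_free_action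
            linear_map_compose[OF linear_free_action linear_free_action] module_W _ x])
        (use u w in \<open>simp_all add: free_action_pure U.m_assoc\<close>)
  next
    fix c x u assume c: "c \<in> carrier K" and x: "x \<in> carrier W" and u: "u \<in> carrier U"
    show "free_action K V U x (c \<odot>\<^bsub>U\<^esub> u) = c \<odot>\<^bsub>W\<^esub> free_action K V U x u"
      by (rule linear_map_eq_on_pure[OF linear_free_action
            linear_map_scale[OF linear_free_action c module_W] module_W _ x])
        (use c u in \<open>simp_all add: free_action_pure U.smult_mult_right pr\<close>)
  qed (simp_all add: lin)
qed

end


section \<open>The free pre-Lie algebra\<close>

text \<open>
  The free pre-Lie algebra \<open>L\<close> on \<open>V\<close> is the quotient of the algebra \<open>A\<close> of binary trees with leaves
  in \<open>V\<close> by an ideal \<open>I\<close>.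
\<close>

locale free_pre_Lie_algebra = V: module K V
  for K :: "('k, 'r) ring_scheme" and V :: "('k, 'v, 's) module_scheme"
begin

abbreviation A :: "('k, 'v magma \<Rightarrow> 'k) module" where
  "A \<equiv> free_nonassoc_algebra K (carrier V)"

abbreviation gen :: "'v \<Rightarrow> 'v magma \<Rightarrow> 'k" where "gen v \<equiv> single K (Gen v)"

text \<open>Killing these elements of \<open>A\<close> makes the generators linear in \<open>V\<close> and the product pre-Lie.\<close>

definition relators :: "('v magma \<Rightarrow> 'k) set" where
  "relators = linear_relators K V A gen \<union> pre_Lie_relators A"

text \<open>The two-sided ideal of \<open>A\<close> generated by them, which is the kernel of the projection to \<open>L\<close>.\<close>

definition I :: "('v magma \<Rightarrow> 'k) set" where "I = generated_nonassoc_ideal K A relators"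

abbreviation L :: "('k, ('v magma \<Rightarrow> 'k) set) module" where "L \<equiv> free_pre_Lie K V"

sublocale F: free_on K "{t. set_magma t \<subseteq> carrier V}" A
  by (rule free_on_free_nonassoc_algebra[OF V.R.is_cring])

sublocale A: nonassoc_algebra K A
  by (rule nonassoc_algebra_free_nonassoc_algebra[OF V.R.is_cring])

lemma gen_closed: "v \<in> carrier V \<Longrightarrow> gen v \<in> carrier A"
  by (rule F.single_closed) simp

lemma relators_subset: "relators \<subseteq> carrier A"
  using linear_relators_subset[OF V.module_axioms F.module_axioms gen_closed]
  by (auto simp: relators_def pre_Lie_relators_def A.mult_closed)

lemma I_subset:
  assumes "submodule N K A" and "relators \<subseteq> N"
    and "\<And>a x. \<lbrakk>a \<in> carrier A; x \<in> N\<rbrakk> \<Longrightarrow> a \<otimes>\<^bsub>A\<^esub> x \<in> N"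
    and "\<And>a x. \<lbrakk>a \<in> carrier A; x \<in> N\<rbrakk> \<Longrightarrow> x \<otimes>\<^bsub>A\<^esub> a \<in> N"
  shows "I \<subseteq> N"
  using assms unfolding I_def generated_nonassoc_ideal_def by blast

lemma relators_in_I: "relators \<subseteq> I"
  unfolding I_def generated_nonassoc_ideal_def by blast

sublocale Q: quotient_nonassoc_algebra K A I
proof (intro quotient_nonassoc_algebra.intro quotient_module.intro quotient_module_axioms.intro
    quotient_nonassoc_algebra_axioms.intro A.nonassoc_algebra_axioms F.module_axioms)
  show "submodule I K A"
    unfolding I_def generated_nonassoc_ideal_def
    using relators_subset F.carrier_is_submodule A.mult_closed
    by (intro F.submodule_Inter) auto
qed (auto simp: I_def generated_nonassoc_ideal_def)

lemma quotient_eq_L: "quotient_algebra A I = L"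
  by (simp add: free_pre_Lie_def I_def relators_def Let_def)

text \<open>The image in \<open>L\<close> of a tree; \<open>tree (Gen v)\<close> is the image of \<open>v\<close>.\<close>

abbreviation tree :: "'v magma \<Rightarrow> ('v magma \<Rightarrow> 'k) set" where "tree t \<equiv> Q.cls (single K t)"

lemmas L_cases = Q.quotient_cases[unfolded quotient_eq_L]
lemmas cls_closed = Q.cls_closed[unfolded quotient_eq_L]
lemmas linear_cls = Q.linear_cls[unfolded quotient_eq_L]
lemmas mult_cls = Q.mult_cls[unfolded quotient_eq_L]

sublocale L: pre_Lie_algebra K L
proof (intro pre_Lie_algebra.intro pre_Lie_algebra_axioms.intro)
  show alg: "nonassoc_algebra K L"
    using Q.nonassoc_algebra_quotient by (simp add: quotient_eq_L)
  have mod: "module K L" using alg by (rule nonassoc_algebra.axioms(1))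
  fix x y z assume "x \<in> carrier L" "y \<in> carrier L" "z \<in> carrier L"
  then obtain a b c where abc: "a \<in> carrier A" "b \<in> carrier A" "c \<in> carrier A"
    and xyz: "x = Q.cls a" "y = Q.cls b" "z = Q.cls c"
    by (metis L_cases)
  let ?l = "(a \<otimes>\<^bsub>A\<^esub> b) \<otimes>\<^bsub>A\<^esub> c \<ominus>\<^bsub>A\<^esub> a \<otimes>\<^bsub>A\<^esub> (b \<otimes>\<^bsub>A\<^esub> c)"
  let ?r = "(a \<otimes>\<^bsub>A\<^esub> c) \<otimes>\<^bsub>A\<^esub> b \<ominus>\<^bsub>A\<^esub> a \<otimes>\<^bsub>A\<^esub> (c \<otimes>\<^bsub>A\<^esub> b)"
  have "?l \<ominus>\<^bsub>A\<^esub> ?r \<in> relators"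
    using abc unfolding relators_def pre_Lie_relators_def by blast
  then have "Q.cls ?l = Q.cls ?r"
    using abc relators_in_I by (auto simp: Q.cls_eq_iff A.mult_closed)
  then show "(x \<otimes>\<^bsub>L\<^esub> y) \<otimes>\<^bsub>L\<^esub> z \<ominus>\<^bsub>L\<^esub> x \<otimes>\<^bsub>L\<^esub> (y \<otimes>\<^bsub>L\<^esub> z) =
      (x \<otimes>\<^bsub>L\<^esub> z) \<otimes>\<^bsub>L\<^esub> y \<ominus>\<^bsub>L\<^esub> x \<otimes>\<^bsub>L\<^esub> (z \<otimes>\<^bsub>L\<^esub> y)"
    using abc by (simp add: xyz linear_map_diff[OF linear_cls F.module_axioms mod] mult_cls
        A.mult_closed)
qed

abbreviation U :: "('k, (('v magma \<Rightarrow> 'k) set list \<Rightarrow> 'k) set) module" where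
  "U \<equiv> enveloping_algebra K (Lie_of L)"

lemma linear_tree_Gen: "linear_map K V L (\<lambda>v. tree (Gen v))"
  using Q.linear_cls_relators[OF V.module_axioms gen_closed] relators_in_I
  by (simp add: quotient_eq_L relators_def)

lemma tree_closed: "set_magma t \<subseteq> carrier V \<Longrightarrow> tree t \<in> carrier L"
  by (simp add: cls_closed F.single_closed)

lemma tree_Node:
  "\<lbrakk>set_magma r \<subseteq> carrier V; set_magma s \<subseteq> carrier V\<rbrakk> \<Longrightarrow>
     tree (Node r s) = tree r \<otimes>\<^bsub>L\<^esub> tree s"
  by (simp add: mult_cls F.single_closed single_mult_single_magma[OF V.R.is_cring])

lemma linear_map_eq_on_trees:
  assumes f: "linear_map K L P f" and g: "linear_map K L P g" and P: "module K P"
    and eq: "\<And>t. set_magma t \<subseteq> carrier V \<Longrightarrow> f (tree t) = g (tree t)" and x: "x \<in> carrier L"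
  shows "f x = g x"
proof -
  from x obtain a where a: "a \<in> carrier A" "x = Q.cls a" by (rule L_cases)
  have "f (Q.cls a) = g (Q.cls a)"
    by (rule F.linear_map_eq_on_basis[OF linear_map_compose[OF linear_cls f]
        linear_map_compose[OF linear_cls g] P _ a(1)]) (use eq in auto)
  with a show ?thesis by simp
qed

end


section \<open>Freeness over the enveloping algebra\<close>

text \<open>
  Recursion along the left spine of a tree only: the right subtrees are passed to \<open>a\<close> unprocessed.
  Thus a tree \<open>(\<dots>(v s\<^sub>1)\<dots>) s\<^sub>n\<close> is sent to \<open>g v\<close>, acted upon by \<open>s\<^sub>1\<close>, \<open>\<dots>\<close>, \<open>s\<^sub>n\<close> in turn.
\<close>

primrec fold_spine :: "('v \<Rightarrow> 'm) \<Rightarrow> ('m \<Rightarrow> 'v magma \<Rightarrow> 'm) \<Rightarrow> 'v magma \<Rightarrow> 'm" where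
  "fold_spine g a (Gen v) = g v"
| "fold_spine g a (Node r s) = a (fold_spine g a r) s"

context free_pre_Lie_algebra begin

text \<open>
  The universal property of \<open>L\<close> as the free right \<open>U\<close>-module on \<open>V\<close>. The map is first defined on trees.
  To see that it vanishes on \<open>I\<close>, consider its kernel inside \<open>I\<close>. This is a two-sided ideal:
  a product \<open>a x\<close> with \<open>x \<in> I\<close> is killed since \<open>x\<close> acts through its class in \<open>L\<close>, which is zero, and
  \<open>x a\<close> is killed whenever \<open>x\<close> is. It contains the relators, the pre-Lie ones because of the
  commutator relations in \<open>U\<close>. So it is all of \<open>I\<close>.
\<close>

theorem module_map_extension:
  fixes M :: "('k, 'm, 'q) module_scheme"
  assumes M: "right_module K U M act" and g: "linear_map K V M g"
  obtains \<phi> where "linear_map K L M \<phi>"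
    and "\<And>v. v \<in> carrier V \<Longrightarrow> \<phi> (tree (Gen v)) = g v"
    and "\<And>x y. \<lbrakk>x \<in> carrier L; y \<in> carrier L\<rbrakk> \<Longrightarrow> \<phi> (x \<otimes>\<^bsub>L\<^esub> y) = act (\<phi> x) (L.E.word [y])"
proof -
  interpret M: right_module K U M act by fact
  have mod: "module K M" by (rule M.M.module_axioms)
  define p where "p = fold_spine g (\<lambda>m s. act m (L.E.word [tree s]))"
  have word: "L.E.word [x] \<in> carrier U" if "x \<in> carrier L" for x
    using that by (simp add: L.E.word_closed)
  have p: "p t \<in> carrier M" if "set_magma t \<subseteq> carrier V" for t
    using that
    by (induction t) (simp_all add: p_def linear_map_closed[OF g] M.act_closed word tree_closed)
  define \<Phi> where "\<Phi> = linear_extension K M p"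
  have lin: "linear_map K A M \<Phi>"
    unfolding \<Phi>_def by (rule F.linear_linear_extension[OF mod]) (simp add: p)
  have single: "\<Phi> (single K t) = p t" if "set_magma t \<subseteq> carrier V" for t
    unfolding \<Phi>_def by (rule F.linear_extension_single[OF mod]) (use that in \<open>simp_all add: p\<close>)
  have act_left: "linear_map K M M (\<lambda>m. act m u)" if "u \<in> carrier U" for u
    using that by (intro linear_mapI) (simp_all add: M.act_closed M.act_add_left M.act_smult_left)
  have act_right: "linear_map K U M (\<lambda>u. act m u)" if "m \<in> carrier M" for m
    using that by (intro linear_mapI) (simp_all add: M.act_closed M.act_add_right M.act_smult_right)
  have word_lin: "linear_map K A U (\<lambda>a. L.E.word [Q.cls a])"
    using linear_map_compose[OF linear_cls]
      L.E.linear_word_single[unfolded L.linear_map_Lie_of_iff] by blast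
  have mult: "\<Phi> (a \<otimes>\<^bsub>A\<^esub> b) = act (\<Phi> a) (L.E.word [Q.cls b])"
    if a: "a \<in> carrier A" and b: "b \<in> carrier A" for a b
  proof -
    have 1: "\<Phi> (single K r \<otimes>\<^bsub>A\<^esub> b) = act (\<Phi> (single K r)) (L.E.word [Q.cls b])"
      if r: "r \<in> {t. set_magma t \<subseteq> carrier V}" for r
    proof (rule F.linear_map_eq_on_basis[OF linear_map_compose[OF A.mult_linear_right lin]
            linear_map_compose[OF word_lin act_right] mod _ b])
      show "single K r \<in> carrier A" using r by (rule F.single_closed)
      show "\<Phi> (single K r) \<in> carrier M" using r by (simp add: single p)
      fix s assume s: "s \<in> {t. set_magma t \<subseteq> carrier V}"
      show "\<Phi> (single K r \<otimes>\<^bsub>A\<^esub> single K s) = act (\<Phi> (single K r)) (L.E.word [tree s])"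
        using r s by (simp add: single_mult_single_magma[OF V.R.is_cring] single) (simp add: p_def)
    qed
    show ?thesis
      by (rule F.linear_map_eq_on_basis[OF linear_map_compose[OF A.mult_linear_left[OF b] lin]
            linear_map_compose[OF lin act_left] mod 1 a])
        (simp add: b word cls_closed)
  qed
  have word_zero: "L.E.word [\<zero>\<^bsub>L\<^esub>] = \<zero>\<^bsub>U\<^esub>"
    using linear_map_zero[OF L.E.linear_word_single L.module_Lie_of L.E.module_U] by simp
  have act_zero: "act m \<zero>\<^bsub>U\<^esub> = \<zero>\<^bsub>M\<^esub>" if "m \<in> carrier M" for m
    using linear_map_zero[OF act_right[OF that] L.E.module_U mod] .
  have zero_act: "act \<zero>\<^bsub>M\<^esub> u = \<zero>\<^bsub>M\<^esub>" if "u \<in> carrier U" for u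
    using linear_map_zero[OF act_left[OF that] mod mod] .
  define N where "N = I \<inter> {a \<in> carrier A. \<Phi> a = \<zero>\<^bsub>M\<^esub>}"
  have "I \<subseteq> N"
  proof (rule I_subset)
    show "submodule N K A"
      unfolding N_def by (intro F.submodule_Int Q.submodule submodule_kernel[OF lin F.module_axioms mod])
    show "relators \<subseteq> N"
    proof
      fix r assume r: "r \<in> relators"
      have "\<Phi> r = \<zero>\<^bsub>M\<^esub>" if "r \<in> linear_relators K V A gen"
      proof (rule linear_relators_vanish[OF lin _ V.module_axioms F.module_axioms mod gen_closed that])
        show "linear_map K V M (\<lambda>v. \<Phi> (gen v))"
          by (rule linear_map_cong[OF g V.module_axioms]) (simp add: single p_def)
      qed
      moreover have "\<Phi> r = \<zero>\<^bsub>M\<^esub>" if "r \<in> pre_Lie_relators A"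
      proof -
        obtain x y z where xyz: "x \<in> carrier A" "y \<in> carrier A" "z \<in> carrier A"
          and r: "r = ((x \<otimes>\<^bsub>A\<^esub> y) \<otimes>\<^bsub>A\<^esub> z \<ominus>\<^bsub>A\<^esub> x \<otimes>\<^bsub>A\<^esub> (y \<otimes>\<^bsub>A\<^esub> z)) \<ominus>\<^bsub>A\<^esub>
             ((x \<otimes>\<^bsub>A\<^esub> z) \<otimes>\<^bsub>A\<^esub> y \<ominus>\<^bsub>A\<^esub> x \<otimes>\<^bsub>A\<^esub> (z \<otimes>\<^bsub>A\<^esub> y))"
          using \<open>r \<in> pre_Lie_relators A\<close> unfolding pre_Lie_relators_def
          by (elim CollectE exE conjE) (rule that)
        define m a b where "m = \<Phi> x" and "a = Q.cls y" and "b = Q.cls z"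
        have c: "m \<in> carrier M" "a \<in> carrier L" "b \<in> carrier L"
          using xyz linear_map_closed[OF lin] by (simp_all add: m_def a_def b_def cls_closed)
        let ?a = "L.E.word [a]" and ?b = "L.E.word [b]"
        let ?ab = "L.E.word [a \<otimes>\<^bsub>L\<^esub> b]" and ?ba = "L.E.word [b \<otimes>\<^bsub>L\<^esub> a]"
        have wc: "?a \<in> carrier U" "?b \<in> carrier U" "?ab \<in> carrier U" "?ba \<in> carrier U"
          using c by (simp_all add: word L.mult_closed)
        have "?a \<otimes>\<^bsub>U\<^esub> ?b \<ominus>\<^bsub>U\<^esub> ?b \<otimes>\<^bsub>U\<^esub> ?a = ?ab \<ominus>\<^bsub>U\<^esub> ?ba"
          using L.E.word_commutator[of a b] c
            linear_map_diff[OF L.E.linear_word_single[unfolded L.linear_map_Lie_of_iff]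
              L.module_axioms L.E.module_U, of "a \<otimes>\<^bsub>L\<^esub> b" "b \<otimes>\<^bsub>L\<^esub> a"]
          by (simp add: L.mult_closed)
        from abelian_group.minus_eq_minus_swap[OF module.axioms(2)[OF L.E.module_U] _ _ _ _ this]
        have "?a \<otimes>\<^bsub>U\<^esub> ?b \<ominus>\<^bsub>U\<^esub> ?ab = ?b \<otimes>\<^bsub>U\<^esub> ?a \<ominus>\<^bsub>U\<^esub> ?ba"
          using wc M.U.mult_closed by simp
        \<comment> \<open>Letting both sides act on \<open>\<Phi> x\<close> gives the value of \<open>\<Phi>\<close> on the pre-Lie relator.\<close>
        then have "act m (?a \<otimes>\<^bsub>U\<^esub> ?b \<ominus>\<^bsub>U\<^esub> ?ab) = act m (?b \<otimes>\<^bsub>U\<^esub> ?a \<ominus>\<^bsub>U\<^esub> ?ba)" by simp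
        then have "act (act m ?a) ?b \<ominus>\<^bsub>M\<^esub> act m ?ab = act (act m ?b) ?a \<ominus>\<^bsub>M\<^esub> act m ?ba"
          using c wc by (simp add: linear_map_diff[OF act_right L.E.module_U mod] M.act_mult)
        then show ?thesis
          using xyz c wc
          by (simp add: r linear_map_diff[OF lin F.module_axioms mod] mult A.mult_closed
              mult_cls[symmetric] m_def[symmetric] a_def[symmetric] b_def[symmetric]
              M.M.minus_eq_zero_iff M.act_closed)
      qed
      ultimately show "r \<in> N"
        using r relators_subset relators_in_I by (auto simp: N_def relators_def)
    qed
    fix a x assume a: "a \<in> carrier A" and "x \<in> N"
    then have x: "x \<in> carrier A" "x \<in> I" "\<Phi> x = \<zero>\<^bsub>M\<^esub>" by (auto simp: N_def)
    have "Q.cls x = \<zero>\<^bsub>L\<^esub>" using x Q.cls_eq_zero_iff by (simp add: quotient_eq_L)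
    then have "\<Phi> (a \<otimes>\<^bsub>A\<^esub> x) = \<zero>\<^bsub>M\<^esub>"
      using mult[OF a x(1)] linear_map_closed[OF lin a] by (simp add: word_zero act_zero)
    then show "a \<otimes>\<^bsub>A\<^esub> x \<in> N"
      using a x Q.ideal_left by (simp add: N_def A.mult_closed)
    have "\<Phi> (x \<otimes>\<^bsub>A\<^esub> a) = \<zero>\<^bsub>M\<^esub>"
      using mult[OF x(1) a] a x by (simp add: zero_act word cls_closed)
    then show "x \<otimes>\<^bsub>A\<^esub> a \<in> N"
      using a x Q.ideal_right by (simp add: N_def A.mult_closed)
  qed
  then have van: "\<Phi> a = \<zero>\<^bsub>M\<^esub>" if "a \<in> I" for a using that by (auto simp: N_def)
  define \<phi> where "\<phi> X = the_elem (\<Phi> ` X)" for X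
  have \<phi>_cls: "\<phi> (Q.cls a) = \<Phi> a" if "a \<in> carrier A" for a
    unfolding \<phi>_def by (rule Q.the_elem_image_cls[OF lin mod van that])
  show thesis
  proof
    show "linear_map K L M \<phi>"
      using Q.linear_the_elem_image[OF lin mod van] by (simp add: quotient_eq_L \<phi>_def[abs_def])
    show "\<phi> (tree (Gen v)) = g v" if "v \<in> carrier V" for v
      using that by (simp add: \<phi>_cls gen_closed single p_def)
    show "\<phi> (x \<otimes>\<^bsub>L\<^esub> y) = act (\<phi> x) (L.E.word [y])" if "x \<in> carrier L" "y \<in> carrier L" for x y
      using that by (auto elim!: L_cases simp: mult_cls \<phi>_cls mult A.mult_closed)
  qed
qed

sublocale W: free_right_module K V U
  by (intro free_right_module.intro V.module_axioms L.E.assoc_algebra_U)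

text \<open>
  The extension \<open>\<phi>\<close> of \<open>v \<mapsto> v \<otimes> 1\<close> has the inverse \<open>\<psi>\<close> with \<open>\<psi> (v \<otimes> u) = v \<cdot> u\<close>.
\<close>

theorem right_module_iso_exists:
  "\<exists>\<phi>. \<phi> \<in> right_module_iso K U L (pre_Lie_action K L) W.W (free_action K V U)"
proof -
  let ?actL = "pre_Lie_action K L" and ?actW = "free_action K V U"
  have RL: "right_module K U L ?actL" by (rule L.right_module_pre_Lie_action)
  have RW: "right_module K U W.W ?actW" by (rule W.right_module_free_action)
  interpret RL: right_module K U L ?actL by (rule RL)
  interpret RW: right_module K U W.W ?actW by (rule RW)
  have pure_one: "linear_map K V W.W (\<lambda>v. W.pure v \<one>\<^bsub>U\<^esub>)"
    by (rule W.linear_pure_left) simp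
  obtain \<phi> where \<phi>: "linear_map K L W.W \<phi>"
    and \<phi>_Gen: "\<And>v. v \<in> carrier V \<Longrightarrow> \<phi> (tree (Gen v)) = W.pure v \<one>\<^bsub>U\<^esub>"
    and \<phi>_mult: "\<And>x y. \<lbrakk>x \<in> carrier L; y \<in> carrier L\<rbrakk> \<Longrightarrow>
       \<phi> (x \<otimes>\<^bsub>L\<^esub> y) = ?actW (\<phi> x) (L.E.word [y])"
    by (rule module_map_extension[OF RW pure_one]) (rule that)
  have \<phi>_act: "\<phi> (?actL x u) = ?actW (\<phi> x) u" if "x \<in> carrier L" "u \<in> carrier U" for x u
    by (rule L.E.equivariant_on_generators[OF RL RW \<phi> _ that])
      (simp add: L.pre_Lie_action_word_single \<phi>_mult)
  let ?g = "\<lambda>(v, u). ?actL (tree (Gen v)) u"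
  have Gen: "tree (Gen v) \<in> carrier L" if "v \<in> carrier V" for v
    using that by (simp add: tree_closed)
  have left: "linear_map K V L (\<lambda>v. ?g (v, u))" if "u \<in> carrier U" for u
  proof -
    have "linear_map K L L (\<lambda>x. ?actL x u)"
      using that by (intro linear_mapI) (simp_all add: RL.act_closed RL.act_add_left RL.act_smult_left)
    from linear_map_compose[OF linear_tree_Gen this] show ?thesis by simp
  qed
  have right: "linear_map K U L (\<lambda>u. ?g (v, u))" if "v \<in> carrier V" for v
    using Gen[OF that]
    by (intro linear_mapI) (simp_all add: RL.act_closed RL.act_add_right RL.act_smult_right)
  define \<psi> where "\<psi> t = the_elem (linear_extension K L ?g ` t)" for t
  have \<psi>: "linear_map K W.W L \<psi>"
    unfolding \<psi>_def by (rule W.linear_tensor_lift[OF L.module_axioms left right])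
  have \<psi>_pure: "\<psi> (W.pure v u) = ?actL (tree (Gen v)) u" if "v \<in> carrier V" "u \<in> carrier U" for v u
    unfolding \<psi>_def using W.tensor_lift_pure[OF L.module_axioms left right that] by simp
  have \<psi>_act: "\<psi> (?actW t w) = ?actL (\<psi> t) w" if t: "t \<in> carrier W.W" and w: "w \<in> carrier U" for t w
  proof (rule W.linear_map_eq_on_pure[OF linear_map_compose[OF W.linear_free_action[OF w] \<psi>]
        linear_map_compose[OF \<psi>] L.module_axioms _ t])
    show "linear_map K L L (\<lambda>x. ?actL x w)"
      using w by (intro linear_mapI) (simp_all add: RL.act_closed RL.act_add_left RL.act_smult_left)
    fix v u assume "v \<in> carrier V" "u \<in> carrier U"
    with w show "\<psi> (?actW (W.pure v u) w) = ?actL (\<psi> (W.pure v u)) w"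
      by (simp add: W.free_action_pure \<psi>_pure RL.act_mult Gen)
  qed
  \<comment> \<open>Both composites commute with the action of \<open>U\<close> and fix the generators.\<close>
  have \<psi>\<phi>: "\<psi> (\<phi> x) = x" if "x \<in> carrier L" for x
  proof (rule linear_map_eq_on_trees[OF linear_map_compose[OF \<phi> \<psi>] linear_map_id L.module_axioms _ that])
    fix t :: "'v magma" assume "set_magma t \<subseteq> carrier V"
    then show "\<psi> (\<phi> (tree t)) = tree t"
    proof (induction t)
      case (Gen v)
      then show ?case
        using tree_closed[of "Gen v"] by (simp add: \<phi>_Gen \<psi>_pure RL.act_one)
    next
      case (Node r s)
      then have "tree r \<in> carrier L" "tree s \<in> carrier L" by (simp_all add: tree_closed)
      moreover from this have "L.E.word [tree s] \<in> carrier U" by (simp add: L.E.word_closed)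
      ultimately show ?case
        using Node by (simp add: tree_Node \<phi>_mult \<psi>_act linear_map_closed[OF \<phi>]
            L.pre_Lie_action_word_single)
    qed
  qed
  have \<phi>\<psi>: "\<phi> (\<psi> t) = t" if "t \<in> carrier W.W" for t
    by (rule W.linear_map_eq_on_pure[OF linear_map_compose[OF \<psi> \<phi>] linear_map_id W.module_W _ that])
      (simp add: \<psi>_pure \<phi>_act Gen \<phi>_Gen W.free_action_pure)
  have "bij_betw \<phi> (carrier L) (carrier W.W)"
    by (rule bij_betw_byWitness[where f' = \<psi>])
      (use \<psi>\<phi> \<phi>\<psi> linear_map_closed[OF \<phi>] linear_map_closed[OF \<psi>] in auto)
  then have "\<phi> \<in> right_module_iso K U L ?actL W.W ?actW"
    using linear_mapD[OF \<phi>] \<phi>_act by (simp add: right_module_iso_def)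
  then show ?thesis by (rule exI[of _ \<phi>])
qed

end

theorem mainTheorem3:
  fixes K :: "('k, 'r) ring_scheme" and V :: "('k, 'v, 's) module_scheme"
  assumes "field K" and "char_zero K" and "module K V"
  shows "let L = free_pre_Lie K V;
             U = enveloping_algebra K (Lie_of L);
             W = tensor_product K V U
         in right_module K U L (pre_Lie_action K L) \<and>
            right_module K U W (free_action K V U) \<and>
            (\<exists>\<phi>. \<phi> \<in> right_module_iso K U L (pre_Lie_action K L) W (free_action K V U))"
proof -
  interpret free_pre_Lie_algebra K V using assms(3) by (rule free_pre_Lie_algebra.intro)
  show ?thesis
    unfolding Let_def
    using L.right_module_pre_Lie_action W.right_module_free_action right_module_iso_exists by blast
qed

end
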